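(* The eigenvalues of the action of $t$ on $H^1(U, V)$ are $\epsilon ^{l_1+2}(\epsilon ^{\prime})^{-l_2}$ and $\epsilon ^{-l_1-2}(\epsilon ^{\prime})^{l_2}$. In particular, $H^1(U, V)^{P/U}=0$.
   Context: Let $F$ be a real quadratic field with ring of integers $\mathcal O_F=\mathbf Z+\mathbf Z\omega$, let $\epsilon$ be the fundamental unit of $F$, and for $x\in F$ let $x'$ denote its Galois conjugate. Let $\Gamma={\rm PSL}(2,\mathcal O_F)$ and define the subgroups $P=\{\begin{pmatrix} t & 0\\ u & t^{-1}\end{pmatrix} : t\in\mathcal O_F^{\times}, u\in\mathcal O_F\}/\{\pm 1_2\}$ and $U=\{\begin{pmatrix} \pm1 & 0\\ u & \pm1\end{pmatrix} : u\in\mathcal O_F\}/\{\pm 1_2\}$. Put $t=\begin{pmatrix} \epsilon^{-1} & 0\\ 0 & \epsilon\end{pmatrix}\in P$; $P/U$ is infinite cyclic generated by the class of $t$. Let $l_1\ge l_2\ge 0$ be integers with $l_1\equiv l_2 \bmod 2$. For $l\ge0$ let $\rho_l$ be the symmetric tensor representation of ${\rm GL}(2,\mathbf C)$ of degree $l$ on $\mathbf C^{l+1}$, defined by $\rho_l(g){}^t(u^l, u^{l-1}v,\dots,v^l)={}^t(u'^l,\dots,v'^l)$ where ${}^t(u',v')=g\,{}^t(u,v)$. Let $V=V_1\otimes V_2$ with $V_i=\mathbf C^{l_i+1}$, on which $\gamma\in\Gamma$ acts by $\rho_{l_1}(\gamma)\otimes\rho_{l_2}(\gamma')$, $\gamma'$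 being the Galois conjugate matrix. The action of $t$ on $H^q(U,V)$ is induced by sending a cocycle $f$ to $(n_1,\dots,n_q)\mapsto t^{-1}f(tn_1t^{-1},\dots,tn_qt^{-1})$. *)

theory Defs
  imports
    "HOL-Library.Function_Algebras"
    "HOL-Number_Theory.Cong"
    "HOL-Algebra.Coset"
    "Jordan_Normal_Form.Determinant"
begin

section \<open>Real quadratic fields\<close>

text \<open>A real quadratic field is taken together with one of its embeddings into the reals, i.e. as a
  subfield of the reals of degree 2 over the rationals.\<close>

definition real_quadratic_field :: "real set \<Rightarrow> bool" where
  "real_quadratic_field F \<longleftrightarrow>
     1 \<in> F \<and> (\<forall>x\<in>F. \<forall>y\<in>F. x - y \<in> F \<and> x * y \<in> F) \<and> (\<forall>x\<in>F. inverse x \<in> F) \<and>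
     vector_space.dim (\<lambda>(q::rat) (x::real). of_rat q * x) F = 2"

definition ring_of_integers :: "real set \<Rightarrow> real set" where
  "ring_of_integers F = {x \<in> F. algebraic_int x}"

definition integer_units :: "real set \<Rightarrow> real set" where
  "integer_units F = {x \<in> ring_of_integers F. \<exists>y \<in> ring_of_integers F. x * y = 1}"

definition fundamental_unit :: "real set \<Rightarrow> real \<Rightarrow> bool" where
  "fundamental_unit F e \<longleftrightarrow>
     e \<in> integer_units F \<and> e > 1 \<and>
     (\<forall>x \<in> integer_units F. \<exists>n::int. x = e powi n \<or> x = - (e powi n))"

text \<open>The values of \<open>c\<close> outside \<open>F\<close> are irrelevant; \<open>\<rat>\<close> is fixed automatically.\<close>

definition galois_conjugation :: "real set \<Rightarrow> (real \<Rightarrow> real) \<Rightarrow> bool" where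
  "galois_conjugation F c \<longleftrightarrow>
     bij_betw c F F \<and>
     (\<forall>x\<in>F. \<forall>y\<in>F. c (x + y) = c x + c y \<and> c (x * y) = c x * c y) \<and>
     (\<exists>x\<in>F. c x \<noteq> x)"


section \<open>The groups\<close>

definition mat22 :: "'a \<Rightarrow> 'a \<Rightarrow> 'a \<Rightarrow> 'a \<Rightarrow> 'a mat" where
  "mat22 a b c d = mat_of_rows_list 2 [[a, b], [c, d]]"

definition SL2 :: "real set \<Rightarrow> real mat monoid" where
  "SL2 R = \<lparr>carrier = {A \<in> carrier_mat 2 2. elements_mat A \<subseteq> R \<and> det A = 1},
            monoid.mult = (*), one = 1\<^sub>m 2\<rparr>"

definition pm_one :: "real mat set" where
  "pm_one = {1\<^sub>m 2, - 1\<^sub>m 2}"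

definition PSL2 :: "real set \<Rightarrow> real mat set monoid" where
  "PSL2 R = SL2 R Mod pm_one"

definition psl_class :: "real set \<Rightarrow> real mat \<Rightarrow> real mat set" where
  "psl_class R A = pm_one #>\<^bsub>SL2 R\<^esub> A"

definition grp_P :: "real set \<Rightarrow> real mat set set" where
  "grp_P F = {psl_class (ring_of_integers F) (mat22 t 0 u (inverse t)) | t u.
                t \<in> integer_units F \<and> u \<in> ring_of_integers F}"

definition grp_U :: "real set \<Rightarrow> real mat set set" where
  "grp_U F = {psl_class (ring_of_integers F) (mat22 s 0 u s) | s u.
                s \<in> {1, -1} \<and> u \<in> ring_of_integers F}"

definition elem_t :: "real set \<Rightarrow> real \<Rightarrow> real mat set" where
  "elem_t F e = psl_class (ring_of_integers F) (mat22 (inverse e) 0 0 e)"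


section \<open>The representation\<close>

definition monomial_vec :: "nat \<Rightarrow> complex \<Rightarrow> complex \<Rightarrow> complex vec" where
  "monomial_vec l u v = vec (l + 1) (\<lambda>i. u ^ (l - i) * v ^ i)"

definition sym_rep :: "nat \<Rightarrow> complex mat \<Rightarrow> complex mat" where
  "sym_rep l g = (THE M. M \<in> carrier_mat (l + 1) (l + 1) \<and>
     (\<forall>u v. M *\<^sub>v monomial_vec l u v =
        monomial_vec l ((g *\<^sub>v vec_of_list [u, v]) $ 0) ((g *\<^sub>v vec_of_list [u, v]) $ 1)))"

lemma homogenize_linear_mult:
  fixes a b u v :: complex
  assumes "degree p \<le> m"
  shows "(\<Sum>j\<le>Suc m. coeff ([:a, b:] * p) j * (u ^ (Suc m - j) * v ^ j)) =
         (a * u + b * v) * (\<Sum>j\<le>m. coeff p j * (u ^ (m - j) * v ^ j))"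
proof -
  have c0: "coeff p (Suc m) = 0"
    using assms by (simp add: coeff_eq_0)
  have "(\<Sum>j\<le>Suc m. coeff ([:a, b:] * p) j * (u ^ (Suc m - j) * v ^ j)) =
        (\<Sum>j\<le>Suc m. a * coeff p j * (u ^ (Suc m - j) * v ^ j)) +
        (\<Sum>j\<le>Suc m. coeff (pCons 0 (smult b p)) j * (u ^ (Suc m - j) * v ^ j))"
    by (simp add: algebra_simps sum.distrib)
  also have "(\<Sum>j\<le>Suc m. a * coeff p j * (u ^ (Suc m - j) * v ^ j)) =
             (\<Sum>j\<le>m. a * coeff p j * (u ^ (Suc m - j) * v ^ j))"
    by (simp add: c0)
  also have "\<dots> = a * u * (\<Sum>j\<le>m. coeff p j * (u ^ (m - j) * v ^ j))"
    unfolding sum_distrib_left by (rule sum.cong) (auto simp: Suc_diff_le)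
  also have "(\<Sum>j\<le>Suc m. coeff (pCons 0 (smult b p)) j * (u ^ (Suc m - j) * v ^ j)) =
             b * v * (\<Sum>j\<le>m. coeff p j * (u ^ (m - j) * v ^ j))"
    by (subst sum.atMost_Suc_shift) (simp add: sum_distrib_left algebra_simps)
  finally show ?thesis
    by (simp add: algebra_simps)
qed

lemma homogenize_power_mult:
  fixes a b u v :: complex
  assumes "degree p \<le> m"
  shows "degree ([:a, b:] ^ n * p) \<le> n + m \<and>
         (\<Sum>j\<le>n + m. coeff ([:a, b:] ^ n * p) j * (u ^ (n + m - j) * v ^ j)) =
         (a * u + b * v) ^ n * (\<Sum>j\<le>m. coeff p j * (u ^ (m - j) * v ^ j))"
proof (induction n)
  case 0
  then show ?case using assms by simp
next
  case (Suc n)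
  let ?q = "[:a, b:] ^ n * p"
  have "degree ([:a, b:] * ?q) \<le> degree [:a, b:] + degree ?q"
    by (rule degree_mult_le)
  also have "\<dots> \<le> 1 + (n + m)"
    using Suc by (intro add_mono) auto
  finally have "degree ([:a, b:] * ?q) \<le> Suc n + m"
    by simp
  moreover have "[:a, b:] ^ Suc n * p = [:a, b:] * ?q"
    by (simp only: power_Suc mult.assoc)
  ultimately show ?case
    using homogenize_linear_mult[of ?q "n + m" a b u v] Suc by (simp only: add_Suc power_Suc mult.assoc)
qed

text \<open>The defining property of \<open>sym_rep\<close> determines a matrix, whose entry at \<open>(i, j)\<close> is the
  coefficient of \<open>u\<^bsup>l-j\<^esup> v\<^sup>j\<close> in \<open>(a u + b v)\<^bsup>l-i\<^esup> (c u + d v)\<^sup>i\<close>.\<close>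

lemma sym_rep_unique_eq:
  assumes "g \<in> carrier_mat 2 2"
  shows "\<exists>!M. M \<in> carrier_mat (l + 1) (l + 1) \<and>
     (\<forall>u v. M *\<^sub>v monomial_vec l u v =
        monomial_vec l ((g *\<^sub>v vec_of_list [u, v]) $ 0) ((g *\<^sub>v vec_of_list [u, v]) $ 1))"
    and "sym_rep l g = mat (l + 1) (l + 1) (\<lambda>(i, j).
       coeff ([:g $$ (0, 0), g $$ (0, 1):] ^ (l - i) * [:g $$ (1, 0), g $$ (1, 1):] ^ i) j)"
proof -
  let ?a = "g $$ (0, 0)" and ?b = "g $$ (0, 1)" and ?c = "g $$ (1, 0)" and ?d = "g $$ (1, 1)"
  let ?q = "\<lambda>i. [:?a, ?b:] ^ (l - i) * [:?c, ?d:] ^ i"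
  let ?M = "mat (l + 1) (l + 1) (\<lambda>(i, j). coeff (?q i) j)"
  let ?P = "\<lambda>M. M \<in> carrier_mat (l + 1) (l + 1) \<and>
     (\<forall>u v. M *\<^sub>v monomial_vec l u v =
        monomial_vec l ((g *\<^sub>v vec_of_list [u, v]) $ 0) ((g *\<^sub>v vec_of_list [u, v]) $ 1))"
  have g0: "(g *\<^sub>v vec_of_list [u, v]) $ 0 = ?a * u + ?b * v"
    and g1: "(g *\<^sub>v vec_of_list [u, v]) $ 1 = ?c * u + ?d * v" for u v
    using assms by (auto simp: scalar_prod_def numeral_2_eq_2)
  have mv: "(M *\<^sub>v monomial_vec l u v) $ i = (\<Sum>j\<le>l. M $$ (i, j) * (u ^ (l - j) * v ^ j))"
    if "M \<in> carrier_mat (l + 1) (l + 1)" "i \<le> l" for M u v i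
    using that by (auto simp: scalar_prod_def monomial_vec_def atLeast0LessThan lessThan_Suc_atMost
        intro!: sum.cong)
  have dimmv: "dim_vec (M *\<^sub>v monomial_vec l u v) = l + 1"
    if "M \<in> carrier_mat (l + 1) (l + 1)" for M u v
    using that by simp
  have ex: "?P ?M"
  proof (intro conjI allI)
    fix u v
    show "?M *\<^sub>v monomial_vec l u v =
        monomial_vec l ((g *\<^sub>v vec_of_list [u, v]) $ 0) ((g *\<^sub>v vec_of_list [u, v]) $ 1)"
    proof (rule eq_vecI)
      fix i assume "i < dim_vec (monomial_vec l ((g *\<^sub>v vec_of_list [u, v]) $ 0)
        ((g *\<^sub>v vec_of_list [u, v]) $ 1))"
      then have i: "i \<le> l" by (simp add: monomial_vec_def)
      have 1: "degree ([:?c, ?d:] ^ i * 1) \<le> i + 0 \<and>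
         (\<Sum>j\<le>i + 0. coeff ([:?c, ?d:] ^ i * 1) j * (u ^ (i + 0 - j) * v ^ j)) =
         (?c * u + ?d * v) ^ i * (\<Sum>j\<le>0. coeff 1 j * (u ^ (0 - j) * v ^ j))"
        by (rule homogenize_power_mult) simp
      have "(\<Sum>j\<le>l. coeff (?q i) j * (u ^ (l - j) * v ^ j)) =
            (?a * u + ?b * v) ^ (l - i) * (?c * u + ?d * v) ^ i"
        using 1 homogenize_power_mult[of "[:?c, ?d:] ^ i" i ?a ?b "l - i" u v] i by simp
      moreover have "(?M *\<^sub>v monomial_vec l u v) $ i =
          (\<Sum>j\<le>l. coeff (?q i) j * (u ^ (l - j) * v ^ j))"
        using i by (subst mv) (auto intro!: sum.cong)
      ultimately show "(?M *\<^sub>v monomial_vec l u v) $ i =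
        monomial_vec l ((g *\<^sub>v vec_of_list [u, v]) $ 0) ((g *\<^sub>v vec_of_list [u, v]) $ 1) $ i"
        unfolding g0 g1 using i by (simp add: monomial_vec_def)
    qed (simp add: monomial_vec_def)
  qed simp
  have uniq: "M = ?M" if M: "?P M" for M
  proof (rule eq_matI)
    fix i j assume "i < dim_row ?M" "j < dim_col ?M"
    then have ij: "i \<le> l" "j \<le> l" by auto
    have "\<forall>v. (\<Sum>j\<le>l. M $$ (i, j) * v ^ j) = (\<Sum>j\<le>l. ?M $$ (i, j) * v ^ j)"
    proof
      fix v
      have "(M *\<^sub>v monomial_vec l 1 v) $ i = (?M *\<^sub>v monomial_vec l 1 v) $ i"
        using M ex by metis
      then show "(\<Sum>j\<le>l. M $$ (i, j) * v ^ j) = (\<Sum>j\<le>l. ?M $$ (i, j) * v ^ j)"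
        using mv[of M i 1 v] mv[of ?M i 1 v] M ij by simp
    qed
    then show "M $$ (i, j) = ?M $$ (i, j)"
      using polyfun_eq_coeffs[of "\<lambda>j. M $$ (i, j)" l "\<lambda>j. ?M $$ (i, j)"] ij by blast
  qed (use M in auto)
  show "\<exists>!M. ?P M"
    using ex uniq by (rule ex1I)
  show "sym_rep l g = ?M"
    unfolding sym_rep_def using ex uniq by (rule the_equality)
qed

text \<open>The tensor product of \<open>\<complex>\<^bsup>m+1\<^esup>\<close> and \<open>\<complex>\<^bsup>n+1\<^esup>\<close> in the basis of all \<open>e\<^sub>i \<otimes> e\<^sub>j\<close>: a tensor is
  its coordinate function, extended by 0 outside the index range.\<close>

definition tensor_space :: "nat \<Rightarrow> nat \<Rightarrow> (nat \<times> nat \<Rightarrow> complex) set" where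
  "tensor_space m n = {v. \<forall>i j. \<not> (i \<le> m \<and> j \<le> n) \<longrightarrow> v (i, j) = 0}"

definition tensor_act ::
  "complex mat \<Rightarrow> complex mat \<Rightarrow> (nat \<times> nat \<Rightarrow> complex) \<Rightarrow> nat \<times> nat \<Rightarrow> complex" where
  "tensor_act A B v = (\<lambda>(i, j).
     if i < dim_row A \<and> j < dim_row B
     then \<Sum>k<dim_col A. \<Sum>m<dim_col B. A $$ (i, k) * B $$ (j, m) * v (k, m) else 0)"

text \<open>An element of \<open>PSL\<^sub>2\<close> is a set \<open>{g, -g}\<close>; both representatives act in the same way
  when \<open>l\<^sub>1\<close> and \<open>l\<^sub>2\<close> have the same parity, and \<open>the_elem\<close> extracts the common value.\<close>

definition rep_V ::
  "(real \<Rightarrow> real) \<Rightarrow> nat \<Rightarrow> nat \<Rightarrow> real mat set \<Rightarrow> (nat \<times> nat \<Rightarrow> complex) \<Rightarrow> nat \<times> nat \<Rightarrow> complex" where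
  "rep_V c l\<^sub>1 l\<^sub>2 X v = the_elem ((\<lambda>g.
     tensor_act (sym_rep l\<^sub>1 (map_mat complex_of_real g))
                (sym_rep l\<^sub>2 (map_mat complex_of_real (map_mat c g))) v) ` X)"


section \<open>First group cohomology\<close>

text \<open>Here \<open>N\<close> is (the carrier of) a subgroup of \<open>G\<close>, and \<open>G\<close> acts linearly on the space \<open>V\<close> of
  complex-valued functions through \<open>a\<close>. Cochains are extensional functions on \<open>N\<close>, and
  cohomology classes are equivalence classes of cocycles modulo coboundaries.\<close>

definition cocycles1 ::
  "('g, 'r) monoid_scheme \<Rightarrow> 'g set \<Rightarrow> ('i \<Rightarrow> complex) set \<Rightarrow> ('g \<Rightarrow> ('i \<Rightarrow> complex) \<Rightarrow> 'i \<Rightarrow> complex)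
     \<Rightarrow> ('g \<Rightarrow> 'i \<Rightarrow> complex) set" where
  "cocycles1 G N V a =
     {f \<in> N \<rightarrow>\<^sub>E V. \<forall>x\<in>N. \<forall>y\<in>N. f (x \<otimes>\<^bsub>G\<^esub> y) = f x + a x (f y)}"

definition coboundaries1 ::
  "'g set \<Rightarrow> ('i \<Rightarrow> complex) set \<Rightarrow> ('g \<Rightarrow> ('i \<Rightarrow> complex) \<Rightarrow> 'i \<Rightarrow> complex)
     \<Rightarrow> ('g \<Rightarrow> 'i \<Rightarrow> complex) set" where
  "coboundaries1 N V a = {(\<lambda>x\<in>N. a x v - v) | v. v \<in> V}"

definition cohom_rel1 ::
  "('g, 'r) monoid_scheme \<Rightarrow> 'g set \<Rightarrow> ('i \<Rightarrow> complex) set \<Rightarrow> ('g \<Rightarrow> ('i \<Rightarrow> complex) \<Rightarrow> 'i \<Rightarrow> complex)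
     \<Rightarrow> (('g \<Rightarrow> 'i \<Rightarrow> complex) \<times> ('g \<Rightarrow> 'i \<Rightarrow> complex)) set" where
  "cohom_rel1 G N V a = {(f, h). f \<in> cocycles1 G N V a \<and> h \<in> cocycles1 G N V a \<and>
     (\<lambda>x\<in>N. f x - h x) \<in> coboundaries1 N V a}"

definition H1 ::
  "('g, 'r) monoid_scheme \<Rightarrow> 'g set \<Rightarrow> ('i \<Rightarrow> complex) set \<Rightarrow> ('g \<Rightarrow> ('i \<Rightarrow> complex) \<Rightarrow> 'i \<Rightarrow> complex)
     \<Rightarrow> ('g \<Rightarrow> 'i \<Rightarrow> complex) set set" where
  "H1 G N V a = cocycles1 G N V a // cohom_rel1 G N V a"

definition H1_zero ::
  "('g, 'r) monoid_scheme \<Rightarrow> 'g set \<Rightarrow> ('i \<Rightarrow> complex) set \<Rightarrow> ('g \<Rightarrow> ('i \<Rightarrow> complex) \<Rightarrow> 'i \<Rightarrow> complex)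
     \<Rightarrow> ('g \<Rightarrow> 'i \<Rightarrow> complex) set" where
  "H1_zero G N V a = cohom_rel1 G N V a `` {\<lambda>x\<in>N. 0}"

definition H1_scale ::
  "('g, 'r) monoid_scheme \<Rightarrow> 'g set \<Rightarrow> ('i \<Rightarrow> complex) set \<Rightarrow> ('g \<Rightarrow> ('i \<Rightarrow> complex) \<Rightarrow> 'i \<Rightarrow> complex)
     \<Rightarrow> complex \<Rightarrow> ('g \<Rightarrow> 'i \<Rightarrow> complex) set \<Rightarrow> ('g \<Rightarrow> 'i \<Rightarrow> complex) set" where
  "H1_scale G N V a z X = (\<Union>f\<in>X. cohom_rel1 G N V a `` {\<lambda>x\<in>N. \<lambda>i. z * f x i})"

text \<open>The map induced on classes by \<open>f \<mapsto> (n \<mapsto> p\<^sup>-\<^sup>1 f(p n p\<^sup>-\<^sup>1))\<close>, for \<open>p\<close> normalizing \<open>N\<close>.\<close>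

definition H1_act ::
  "('g, 'r) monoid_scheme \<Rightarrow> 'g set \<Rightarrow> ('i \<Rightarrow> complex) set \<Rightarrow> ('g \<Rightarrow> ('i \<Rightarrow> complex) \<Rightarrow> 'i \<Rightarrow> complex)
     \<Rightarrow> 'g \<Rightarrow> ('g \<Rightarrow> 'i \<Rightarrow> complex) set \<Rightarrow> ('g \<Rightarrow> 'i \<Rightarrow> complex) set" where
  "H1_act G N V a p X = (\<Union>f\<in>X. cohom_rel1 G N V a ``
     {\<lambda>n\<in>N. a (inv\<^bsub>G\<^esub> p) (f (p \<otimes>\<^bsub>G\<^esub> n \<otimes>\<^bsub>G\<^esub> inv\<^bsub>G\<^esub> p))})"

definition H1_eigenvalues ::
  "('g, 'r) monoid_scheme \<Rightarrow> 'g set \<Rightarrow> ('i \<Rightarrow> complex) set \<Rightarrow> ('g \<Rightarrow> ('i \<Rightarrow> complex) \<Rightarrow> 'i \<Rightarrow> complex)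
     \<Rightarrow> 'g \<Rightarrow> complex set" where
  "H1_eigenvalues G N V a p =
     {z. \<exists>X \<in> H1 G N V a. X \<noteq> H1_zero G N V a \<and> H1_act G N V a p X = H1_scale G N V a z X}"

text \<open>The invariants of \<open>P/N\<close>: a coset acts through any of its representatives.\<close>

definition H1_invariants ::
  "('g, 'r) monoid_scheme \<Rightarrow> 'g set \<Rightarrow> 'g set \<Rightarrow> ('i \<Rightarrow> complex) set
     \<Rightarrow> ('g \<Rightarrow> ('i \<Rightarrow> complex) \<Rightarrow> 'i \<Rightarrow> complex) \<Rightarrow> ('g \<Rightarrow> 'i \<Rightarrow> complex) set set" where
  "H1_invariants G P N V a =
     {X \<in> H1 G N V a. \<forall>C \<in> carrier (G\<lparr>carrier := P\<rparr> Mod N). \<forall>p\<in>C. H1_act G N V a p X = X}"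

end

theory Submission
  imports Defs "Jordan_Normal_Form.Char_Poly"
begin

text \<open>Identify \<open>U\<close> with the additive group of integers \<open>x\<close> of \<open>F\<close>. On
  \<open>V = \<complex>[X, Y]/(X\<^bsup>m+1\<^esup>, Y\<^bsup>n+1\<^esup>)\<close>, where \<open>(m, n) = (l\<^sub>1, l\<^sub>2)\<close>, the element \<open>x\<close> acts as multiplication by
  \<open>exp(x X + x' Y)\<close>. Every additive map from the integers of \<open>F\<close> to \<open>\<complex>\<close> is a combination of \<open>x\<close> and
  \<open>x'\<close>, so the lowest homogeneous part of a cocycle has the form \<open>x g + x' h\<close>; since \<open>U\<close> is commutative,
  \<open>X h = Y g\<close>. Hence it can be removed by subtracting a coboundary and multiples of the cocycles
  \<open>Y\<^sup>n (exp(x X) - 1)/X\<close> and \<open>X\<^sup>m (exp(x' Y) - 1)/Y\<close>, and by induction on the degree these two span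
  \<open>H\<^sup>1(U, V)\<close>. They are independent, as the linear part in \<open>x\<close> of a coboundary is \<open>(x X + x' Y) v\<close>,
  and they are eigenvectors of \<open>t\<close> with the two asserted eigenvalues. As \<open>\<epsilon> > 1\<close> and \<open>\<epsilon> \<epsilon>' = \<plusminus>1\<close>, neither
  eigenvalue is 1.\<close>

section \<open>Algebraic integers\<close>

text \<open>Conjugation by t multiplies the coordinate of U by \<epsilon>^2, while t^(-1) scales the
  coordinate (i, j) of V by \<epsilon>^(m-2i) \<sigma>(\<epsilon>)^(n-2j). The entry of the first
  cocycle at (i, n) is proportional to x^(i+1), so the exponent of \<epsilon> becomes m - 2i +
  2(i+1) = m + 2 for every i. Thus the cocycle itself, and not only its class, is an eigenvector.
  The same count for the second cocycle gives \<epsilon>^(-m) \<sigma>(\<epsilon>)^(n+2), which is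
  the asserted value because (\<epsilon> \<sigma>(\<epsilon>))^2 = 1. The "linear part in x" needs a
  meaning, as x runs only through the integers of F: evaluation at the multiples k * 1 and k *
  \<epsilon> gives polynomial identities in k, whose linear coefficients are compared. Additive maps
  are determined without an integral basis: \<epsilon> is irrational, so every integer of F has a
  positive integer multiple in Z + Z \<epsilon>, and the values lie in C, where that multiple can be
  divided out.\<close>

definition int_span :: "'a :: comm_ring_1 set \<Rightarrow> 'a set" where
  "int_span S = range (\<lambda>c. \<Sum>s\<in>S. of_int (c s) * s)"

lemma int_span_add: "x \<in> int_span S \<Longrightarrow> y \<in> int_span S \<Longrightarrow> x + y \<in> int_span S"
proof -
  assume "x \<in> int_span S" "y \<in> int_span S"
  then obtain c d where "x = (\<Sum>s\<in>S. of_int (c s) * s)" "y = (\<Sum>s\<in>S. of_int (d s) * s)"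
    by (auto simp: int_span_def)
  then have "x + y = (\<Sum>s\<in>S. of_int (c s + d s) * s)"
    by (simp add: sum.distrib algebra_simps)
  then show ?thesis unfolding int_span_def by (intro range_eqI[where x = "\<lambda>s. c s + d s"])
qed

lemma int_span_zero: "0 \<in> int_span S"
  unfolding int_span_def by (rule range_eqI[where x = "\<lambda>_. 0"]) simp

lemma int_span_scale: "x \<in> int_span S \<Longrightarrow> of_int k * x \<in> int_span S"
proof -
  assume "x \<in> int_span S"
  then obtain c where "x = (\<Sum>s\<in>S. of_int (c s) * s)"
    by (auto simp: int_span_def)
  then have "of_int k * x = (\<Sum>s\<in>S. of_int (k * c s) * s)"
    by (simp add: sum_distrib_left algebra_simps)
  then show ?thesis unfolding int_span_def by (intro range_eqI[where x = "\<lambda>s. k * c s"])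
qed

lemma int_span_sum:
  assumes "\<And>i. i \<in> I \<Longrightarrow> f i \<in> int_span S"
  shows "(\<Sum>i\<in>I. f i) \<in> int_span S"
  using assms by (induction I rule: infinite_finite_induct) (auto intro: int_span_zero int_span_add)

lemma int_span_base:
  assumes "finite S" "x \<in> S"
  shows "x \<in> int_span S"
proof -
  have "(\<Sum>s\<in>S. of_int (if s = x then 1 else 0) * s) = (\<Sum>s\<in>S. if s = x then s else 0)"
    by (rule sum.cong) auto
  also have "\<dots> = x"
    using assms by (simp add: sum.delta)
  finally show ?thesis
    unfolding int_span_def by (intro range_eqI[where x = "\<lambda>s. if s = x then 1 else 0"]) simp
qed

lemma int_span_mult:
  assumes "\<And>s. s \<in> S \<Longrightarrow> z * s \<in> int_span S" "x \<in> int_span S"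
  shows "z * x \<in> int_span S"
proof -
  from assms(2) obtain c where "x = (\<Sum>s\<in>S. of_int (c s) * s)"
    by (auto simp: int_span_def)
  then have "z * x = (\<Sum>s\<in>S. of_int (c s) * (z * s))"
    by (simp add: sum_distrib_left algebra_simps)
  also have "\<dots> \<in> int_span S"
    by (intro int_span_sum int_span_scale assms(1))
  finally show ?thesis .
qed

text \<open>Multiplication by \<open>z\<close> is expressed on the generators by an integer matrix.
  The vector of all generators is an eigenvector for \<open>z\<close>, nonzero because of
  \<open>s\<^sub>0\<close>, so \<open>z\<close> is a root of the characteristic polynomial, which is
  monic and integral.\<close>

lemma algebraic_int_if_int_span_stable:
  fixes z :: "'a :: field_char_0"
  assumes "finite S" "s\<^sub>0 \<in> S" "s\<^sub>0 \<noteq> 0" and stable: "\<And>s. s \<in> S \<Longrightarrow> z * s \<in> int_span S"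
  shows "algebraic_int z"
proof -
  have "\<forall>s\<in>S. \<exists>c. z * s = (\<Sum>r\<in>S. of_int (c r) * r)"
    using stable by (auto simp: int_span_def)
  then obtain c where c: "\<And>s. s \<in> S \<Longrightarrow> z * s = (\<Sum>r\<in>S. of_int (c s r) * r)"
    by metis
  define n where "n = card S"
  obtain h where h: "bij_betw h {0..<n} S"
    using ex_bij_betw_nat_finite[OF \<open>finite S\<close>] unfolding n_def by blast
  define M :: "int mat" where "M = mat n n (\<lambda>(i, j). c (h i) (h j))"
  let ?M = "map_mat of_int M :: 'a mat"
  have M: "M \<in> carrier_mat n n" "?M \<in> carrier_mat n n"
    by (auto simp: M_def)
  obtain i\<^sub>0 where i0: "i\<^sub>0 < n" "h i\<^sub>0 = s\<^sub>0"
    using h assms(2) unfolding bij_betw_def by fastforce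
  have "vec n h $ i\<^sub>0 \<noteq> (0\<^sub>v n :: 'a vec) $ i\<^sub>0"
    using i0 assms(3) by simp
  then have nz: "vec n h \<noteq> 0\<^sub>v n" by metis
  have "?M *\<^sub>v vec n h = z \<cdot>\<^sub>v vec n h"
  proof (rule eq_vecI)
    fix i assume "i < dim_vec (z \<cdot>\<^sub>v vec n h)"
    then have i: "i < n" by simp
    then have hi: "h i \<in> S" using h unfolding bij_betw_def by auto
    have "(?M *\<^sub>v vec n h) $ i = (\<Sum>j = 0..<n. of_int (c (h i) (h j)) * h j)"
      using i by (simp add: M_def scalar_prod_def)
    also have "\<dots> = (\<Sum>r\<in>S. of_int (c (h i) r) * r)"
      by (rule sum.reindex_bij_betw[OF h])
    finally show "(?M *\<^sub>v vec n h) $ i = (z \<cdot>\<^sub>v vec n h) $ i"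
      using c[OF hi] i by simp
  qed (use M in auto)
  then have "eigenvalue ?M z"
    unfolding eigenvalue_def eigenvector_def using M nz by (intro exI[of _ "vec n h"]) auto
  then have "poly (char_poly ?M) z = 0"
    using eigenvalue_root_char_poly[OF M(2)] by simp
  then have "poly (map_poly of_int (char_poly M)) z = 0"
    using of_int_hom.char_poly_hom[OF M(1)] by metis
  moreover have "lead_coeff (char_poly M) = 1"
    using degree_monic_char_poly[OF M(1)] by simp
  ultimately show ?thesis
    unfolding algebraic_int_altdef_ipoly by blast
qed

lemma algebraic_int_power_degree:
  fixes x :: "'a :: field_char_0"
  assumes "algebraic_int x"
  obtains m c where "m > 0" "x ^ m = (\<Sum>i<m. of_int (c i) * x ^ i)"
proof -
  obtain p where p: "poly (map_poly of_int p) x = 0" "lead_coeff p = 1"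
    using assms unfolding algebraic_int_altdef_ipoly by blast
  have "degree p > 0"
  proof (rule ccontr)
    assume "\<not> degree p > 0"
    then have "p = [:1:]" using p(2) by (auto elim!: degree_eq_zeroE)
    with p(1) show False by simp
  qed
  moreover have "x ^ degree p = (\<Sum>i<degree p. of_int (- coeff p i) * x ^ i)"
  proof -
    have "0 = (\<Sum>i\<le>degree p. of_int (coeff p i) * x ^ i)"
      using p(1) by (simp add: poly_altdef degree_map_poly coeff_map_poly)
    also have "\<dots> = x ^ degree p + (\<Sum>i<degree p. of_int (coeff p i) * x ^ i)"
      using p(2) by (simp add: lessThan_Suc_atMost[symmetric])
    finally show ?thesis
      by (simp add: sum_negf eq_neg_iff_add_eq_0)
  qed
  ultimately show ?thesis by (rule that)
qed

text \<open>The monomials \<open>x\<^sup>i y\<^sup>j\<close> with bounded exponents span a lattice stable under multiplication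
  by \<open>x\<close> and \<open>y\<close>, hence by \<open>x + y\<close> and \<open>x y\<close>.\<close>

lemma
  fixes x y :: "'a :: field_char_0"
  assumes "algebraic_int x" "algebraic_int y"
  shows algebraic_int_add: "algebraic_int (x + y)"
    and algebraic_int_mult: "algebraic_int (x * y)"
proof -
  obtain m c where x: "m > 0" "x ^ m = (\<Sum>i<m. of_int (c i) * x ^ i)"
    using algebraic_int_power_degree[OF assms(1)] by metis
  obtain n d where y: "n > 0" "y ^ n = (\<Sum>i<n. of_int (d i) * y ^ i)"
    using algebraic_int_power_degree[OF assms(2)] by metis
  define S where "S = (\<lambda>(i, j). x ^ i * y ^ j) ` ({..<m} \<times> {..<n})"
  have fin: "finite S" by (simp add: S_def)
  have in_S: "x ^ i * y ^ j \<in> int_span S" if "i < m" "j < n" for i j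
    using that by (intro int_span_base fin) (auto simp: S_def)
  have sx: "x * s \<in> int_span S" if "s \<in> S" for s
  proof -
    obtain i j where s: "s = x ^ i * y ^ j" "i < m" "j < n"
      using \<open>s \<in> S\<close> by (auto simp: S_def)
    show ?thesis
    proof (cases "Suc i < m")
      case True
      then show ?thesis using in_S[of "Suc i" j] s by (simp add: mult.assoc)
    next
      case False
      then have "x * s = x ^ m * y ^ j"
        using s by (metis Suc_lessI mult.assoc power_Suc)
      also have "\<dots> = (\<Sum>i<m. of_int (c i) * (x ^ i * y ^ j))"
        by (simp add: x(2) sum_distrib_right mult.assoc)
      also have "\<dots> \<in> int_span S"
        using s by (intro int_span_sum int_span_scale in_S) auto
      finally show ?thesis .
    qed
  qed
  have sy: "y * s \<in> int_span S" if "s \<in> S" for s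
  proof -
    obtain i j where s: "s = x ^ i * y ^ j" "i < m" "j < n"
      using \<open>s \<in> S\<close> by (auto simp: S_def)
    show ?thesis
    proof (cases "Suc j < n")
      case True
      then show ?thesis using in_S[of i "Suc j"] s by (simp add: mult_ac)
    next
      case False
      then have "y * s = x ^ i * y ^ n"
        using s by (metis Suc_lessI mult.left_commute power_Suc)
      also have "\<dots> = (\<Sum>j<n. of_int (d j) * (x ^ i * y ^ j))"
        by (simp add: y(2) sum_distrib_left mult_ac)
      also have "\<dots> \<in> int_span S"
        using s by (intro int_span_sum int_span_scale in_S) auto
      finally show ?thesis .
    qed
  qed
  \<comment> \<open>Positivity of \<open>m\<close> and \<open>n\<close> puts the exponent pair (0,
    0) in range; 1 serves as the nonzero generator that the stability criterion asks for.\<close>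
  have one: "1 \<in> S"
    using x(1) y(1) unfolding S_def by (auto intro!: image_eqI[where x = "(0, 0)"])
  show "algebraic_int (x + y)"
    by (rule algebraic_int_if_int_span_stable[OF fin one])
       (auto simp: distrib_right intro!: int_span_add sx sy)
  show "algebraic_int (x * y)"
    by (rule algebraic_int_if_int_span_stable[OF fin one])
       (use int_span_mult[of S x, OF sx sy] in \<open>auto simp: mult.assoc\<close>)
qed

section \<open>Real quadratic fields\<close>

interpretation rat_real: vector_space "\<lambda>(q::rat) (x::real). of_rat q * x"
  by unfold_locales (auto simp: algebra_simps of_rat_add of_rat_mult)

locale real_quadratic =
  fixes F :: "real set" and \<sigma> :: "real \<Rightarrow> real" and \<epsilon> :: real
  assumes field: "real_quadratic_field F"
    and conj: "galois_conjugation F \<sigma>"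
    and unit: "fundamental_unit F \<epsilon>"
begin

abbreviation \<O> :: "real set" where "\<O> \<equiv> ring_of_integers F"

lemma F_one: "1 \<in> F" and F_diff: "x \<in> F \<Longrightarrow> y \<in> F \<Longrightarrow> x - y \<in> F"
  and F_mult: "x \<in> F \<Longrightarrow> y \<in> F \<Longrightarrow> x * y \<in> F" and F_inverse: "x \<in> F \<Longrightarrow> inverse x \<in> F"
  using field by (auto simp: real_quadratic_field_def)

lemma F_zero: "0 \<in> F"
  using F_diff[OF F_one F_one] by simp

lemma F_uminus: "x \<in> F \<Longrightarrow> - x \<in> F"
  using F_diff[OF F_zero] by simp

lemma F_add: "x \<in> F \<Longrightarrow> y \<in> F \<Longrightarrow> x + y \<in> F"
  using F_diff[of x "- y"] F_uminus by simp

lemma F_of_nat: "of_nat n \<in> F"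
  by (induction n) (auto intro: F_add F_one F_zero)

lemma F_of_int: "of_int n \<in> F"
  by (cases n) (auto intro: F_of_nat F_uminus simp del: of_nat_Suc)

lemma F_of_rat: "of_rat q \<in> F"
proof (cases q)
  case (Fract a b)
  then show ?thesis
    by (auto simp: of_rat_rat divide_inverse intro!: F_mult F_inverse F_of_int)
qed

lemma O_F: "x \<in> \<O> \<Longrightarrow> x \<in> F"
  by (simp add: ring_of_integers_def)

lemma O_add: "x \<in> \<O> \<Longrightarrow> y \<in> \<O> \<Longrightarrow> x + y \<in> \<O>"
  and O_mult: "x \<in> \<O> \<Longrightarrow> y \<in> \<O> \<Longrightarrow> x * y \<in> \<O>"
  and O_uminus: "x \<in> \<O> \<Longrightarrow> - x \<in> \<O>"
  by (auto simp: ring_of_integers_def algebraic_int_add algebraic_int_mult F_add F_mult F_uminus)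

lemma O_of_int: "of_int n \<in> \<O>"
  by (auto simp: ring_of_integers_def F_of_int intro: int_imp_algebraic_int)

lemma O_zero: "0 \<in> \<O>" and O_one: "1 \<in> \<O>" and O_of_nat: "of_nat n \<in> \<O>"
  using O_of_int[of 0] O_of_int[of 1] O_of_int[of "int n"] by simp_all

lemma \<sigma>_add: "x \<in> F \<Longrightarrow> y \<in> F \<Longrightarrow> \<sigma> (x + y) = \<sigma> x + \<sigma> y"
  and \<sigma>_mult: "x \<in> F \<Longrightarrow> y \<in> F \<Longrightarrow> \<sigma> (x * y) = \<sigma> x * \<sigma> y"
  and \<sigma>_F: "x \<in> F \<Longrightarrow> \<sigma> x \<in> F"
  using conj by (auto simp: galois_conjugation_def bij_betw_def)

lemma \<sigma>_inj: "x \<in> F \<Longrightarrow> y \<in> F \<Longrightarrow> \<sigma> x = \<sigma> y \<Longrightarrow> x = y"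
  using conj by (auto simp: galois_conjugation_def bij_betw_def inj_on_def)

lemma \<sigma>_zero: "\<sigma> 0 = 0"
  using \<sigma>_add[OF F_zero F_zero] by simp

text \<open>The image of 1 is idempotent, hence 0 or 1, and injectivity excludes 0.\<close>

lemma \<sigma>_one: "\<sigma> 1 = 1"
  using \<sigma>_mult[OF F_one F_one] \<sigma>_inj[OF F_one F_zero] \<sigma>_zero by auto

lemma \<sigma>_uminus: "x \<in> F \<Longrightarrow> \<sigma> (- x) = - \<sigma> x"
  using \<sigma>_add[of x "- x"] F_uminus[of x] \<sigma>_zero by simp

lemma \<sigma>_of_nat: "\<sigma> (of_nat n) = of_nat n"
  by (induction n) (auto simp: \<sigma>_zero \<sigma>_one \<sigma>_add F_of_nat F_one)

lemma \<sigma>_of_int: "\<sigma> (of_int n) = of_int n"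
  by (cases n) (auto simp: \<sigma>_of_nat \<sigma>_uminus F_of_nat simp del: of_nat_Suc)

lemma \<sigma>_inverse: "x \<in> F \<Longrightarrow> \<sigma> (inverse x) = inverse (\<sigma> x)"
  using \<sigma>_mult[of x "inverse x"] F_inverse[of x] \<sigma>_zero \<sigma>_one
  by (cases "x = 0") (auto intro!: inverse_unique[symmetric])

lemma \<sigma>_of_rat: "\<sigma> (of_rat q) = of_rat q"
proof (cases q)
  case (Fract a b)
  then show ?thesis
    by (simp add: of_rat_rat divide_inverse \<sigma>_mult \<sigma>_inverse \<sigma>_of_int F_inverse F_of_int)
qed

text \<open>Conjugation fixes integer coefficients, so it carries a root of a monic integer
  polynomial to another root; this is how integrality passes to the conjugate.\<close>

lemma \<sigma>_poly:
  assumes "x \<in> F"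
  shows "poly (map_poly of_int p) x \<in> F
    \<and> \<sigma> (poly (map_poly of_int p) x) = poly (map_poly of_int p) (\<sigma> x)"
  by (induction p)
     (auto simp: map_poly_pCons \<sigma>_zero \<sigma>_add \<sigma>_mult \<sigma>_of_int assms F_of_int F_mult F_add F_zero)

lemma \<sigma>_O: "x \<in> \<O> \<Longrightarrow> \<sigma> x \<in> \<O>"
  unfolding ring_of_integers_def algebraic_int_altdef_ipoly using \<sigma>_poly \<sigma>_F \<sigma>_zero
  by (auto, metis)

text \<open>An irrational \<open>x\<close> is independent of 1 over the rationals, and a third
  independent vector would exceed the dimension 2.\<close>

lemma F_basis:
  assumes "x \<in> F" "x \<notin> \<rat>" "y \<in> F"
  obtains p q :: rat where "y = of_rat p + of_rat q * x"
proof -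
  obtain B where B: "B \<subseteq> F" "rat_real.independent B" "F \<subseteq> rat_real.span B" "card B = rat_real.dim F"
    using rat_real.basis_exists by blast
  have "card B = 2" using B(4) field by (simp add: real_quadratic_field_def)
  then have finB: "finite B" by (metis card.infinite zero_neq_numeral)
  have i1: "rat_real.independent {1}" by simp
  have "x \<notin> rat_real.span {1}"
    using assms(2) by (auto simp: rat_real.span_singleton)
  then have i2: "rat_real.independent {x, 1}"
    using i1 rat_real.independent_insertI by blast
  have "y \<in> rat_real.span {x, 1}"
  proof (rule ccontr)
    assume y: "y \<notin> rat_real.span {x, 1}"
    then have i3: "rat_real.independent {y, x, 1}"
      using i2 rat_real.independent_insertI by blast
    have "{y, x, 1} \<subseteq> rat_real.span B"
      using B(3) assms F_one by auto
    then have "card {y, x, 1} \<le> 2"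
      using rat_real.independent_span_bound[OF finB i3] \<open>card B = 2\<close> by simp
    moreover have "x \<noteq> 1" "y \<noteq> x" "y \<noteq> 1"
      using assms(2) y rat_real.span_base[of _ "{x, 1}"] by auto
    ultimately show False by simp
  qed
  then obtain q where "y - of_rat q * x \<in> rat_real.span {1}"
    by (auto simp: rat_real.span_breakdown_eq)
  then obtain p where "y - of_rat q * x = of_rat p"
    by (auto simp: rat_real.span_singleton)
  then show ?thesis using that[of p q] by (simp add: algebra_simps)
qed

text \<open>Expand \<open>y\<close> in the basis 1, \<open>x\<close> with \<open>x\<close> moved by
  \<sigma>: being fixed forces the coordinate of \<open>x\<close> to vanish.\<close>

lemma \<sigma>_fixed_imp_rat:
  assumes "y \<in> F" "\<sigma> y = y"
  shows "y \<in> \<rat>"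
proof -
  obtain x where x: "x \<in> F" "\<sigma> x \<noteq> x"
    using conj by (auto simp: galois_conjugation_def)
  have "x \<notin> \<rat>" using x \<sigma>_of_rat by (auto simp: Rats_def)
  then obtain p q where y: "y = of_rat p + of_rat q * x"
    using F_basis x assms by metis
  have "\<sigma> y = of_rat p + of_rat q * \<sigma> x"
    by (simp add: y \<sigma>_add \<sigma>_mult F_of_rat F_mult x \<sigma>_of_rat)
  then have "q = 0" using assms(2) x(2) y by simp
  then show ?thesis by (simp add: y)
qed

text \<open>Involutivity is not part of the definition of a conjugation. It holds because
  \<open>y\<close> and its image are two distinct roots of one monic quadratic over the rationals,
  so their sum is the rational number \<open>q\<close>.\<close>

lemma \<sigma>_involution:
  assumes "y \<in> F"
  shows "\<sigma> (\<sigma> y) = y"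
proof (cases "y \<in> \<rat>")
  case True
  then show ?thesis using \<sigma>_of_rat by (auto simp: Rats_def)
next
  case False
  then have ne: "\<sigma> y \<noteq> y" using \<sigma>_fixed_imp_rat assms by blast
  obtain p q where y2: "y * y = of_rat p + of_rat q * y"
    using F_basis[OF assms False] F_mult assms by metis
  then have "\<sigma> (y * y) = of_rat p + of_rat q * \<sigma> y"
    by (simp add: \<sigma>_add \<sigma>_mult F_of_rat F_mult assms \<sigma>_of_rat)
  then have "\<sigma> y * \<sigma> y = of_rat p + of_rat q * \<sigma> y"
    by (simp add: \<sigma>_mult assms)
  with y2 have "(\<sigma> y - y) * (\<sigma> y + y - of_rat q) = 0" by (simp add: algebra_simps)
  then have s: "\<sigma> y = of_rat q - y" using ne by auto
  have "\<sigma> (\<sigma> y) = of_rat q + - \<sigma> y"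
    unfolding s[THEN arg_cong[of _ _ \<sigma>]] diff_conv_add_uminus
    by (subst \<sigma>_add) (auto simp: \<sigma>_uminus \<sigma>_of_rat F_of_rat F_uminus assms)
  with s show ?thesis by simp
qed

lemma \<epsilon>_O: "\<epsilon> \<in> \<O>" and \<epsilon>_gt_1: "\<epsilon> > 1" and \<epsilon>_unit: "\<epsilon> \<in> integer_units F"
  using unit by (auto simp: fundamental_unit_def integer_units_def)

lemma unit_inverse_O: "x \<in> integer_units F \<Longrightarrow> inverse x \<in> \<O>"
  unfolding integer_units_def using inverse_unique by blast

lemma inverse_\<epsilon>_O: "inverse \<epsilon> \<in> \<O>"
  by (rule unit_inverse_O[OF \<epsilon>_unit])

text \<open>A rational algebraic integer is an ordinary integer, and the only units among those are
  1 and -1. Applied to \<epsilon> this gives irrationality, applied to the norm of \<epsilon> it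
  gives the value up to sign.\<close>

lemma unit_int_abs:
  assumes "x \<in> \<O>" "inverse x \<in> \<O>" "x \<in> \<rat>" "x \<noteq> 0"
  shows "\<bar>x\<bar> = 1"
proof -
  have "x \<in> \<int>" "inverse x \<in> \<int>"
    using assms by (auto simp: ring_of_integers_def intro!: rational_algebraic_int_is_int)
  then obtain a b :: int where ab: "x = of_int a" "inverse x = of_int b"
    by (auto elim!: Ints_cases)
  have "real_of_int (a * b) = 1" using assms(4) ab by (metis of_int_mult right_inverse)
  then have "a * b = 1" by linarith
  then have "\<bar>a\<bar> = 1" by (auto simp: zmult_eq_1_iff)
  then show ?thesis by (simp add: ab)
qed

lemma \<epsilon>_irrational: "\<epsilon> \<notin> \<rat>"
  using unit_int_abs[OF \<epsilon>_O inverse_\<epsilon>_O] \<epsilon>_gt_1 by auto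

lemma \<sigma>_\<epsilon>_neq: "\<sigma> \<epsilon> \<noteq> \<epsilon>"
  using \<sigma>_fixed_imp_rat \<epsilon>_irrational \<epsilon>_O O_F by blast

lemma \<sigma>_nonzero: "x \<in> F \<Longrightarrow> x \<noteq> 0 \<Longrightarrow> \<sigma> x \<noteq> 0"
  using \<sigma>_inj[of x 0] F_zero \<sigma>_zero by auto

text \<open>The norm is fixed by the involution \<sigma>, hence rational; it is a unit because its
  inverse is the norm of the inverse of \<epsilon>.\<close>

lemma abs_norm_\<epsilon>: "\<bar>\<epsilon> * \<sigma> \<epsilon>\<bar> = 1"
proof (rule unit_int_abs)
  have F: "\<epsilon> \<in> F" by (rule O_F[OF \<epsilon>_O])
  show "\<epsilon> * \<sigma> \<epsilon> \<in> \<O>" by (intro O_mult \<sigma>_O \<epsilon>_O)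
  have "inverse (\<epsilon> * \<sigma> \<epsilon>) = inverse \<epsilon> * \<sigma> (inverse \<epsilon>)"
    by (simp add: \<sigma>_inverse F)
  also have "\<dots> \<in> \<O>" by (intro O_mult \<sigma>_O inverse_\<epsilon>_O)
  finally show "inverse (\<epsilon> * \<sigma> \<epsilon>) \<in> \<O>" .
  show "\<epsilon> * \<sigma> \<epsilon> \<in> \<rat>"
    by (rule \<sigma>_fixed_imp_rat) (auto simp: F_mult \<sigma>_F F \<sigma>_mult \<sigma>_involution)
  show "\<epsilon> * \<sigma> \<epsilon> \<noteq> 0" using \<sigma>_nonzero[OF F] \<epsilon>_gt_1 by auto
qed

lemma abs_\<sigma>_\<epsilon>: "\<bar>\<sigma> \<epsilon>\<bar> = inverse \<epsilon>"
  using abs_norm_\<epsilon> \<epsilon>_gt_1 by (simp add: abs_mult field_simps)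

text \<open>The functions x and \<sigma>(x) separate 1 and \<epsilon>, so some combination agrees
  with \<open>f\<close> at these two points. Both sides are additive, and a positive multiple of
  each integer lies in Z + Z \<epsilon>, so they agree everywhere.\<close>

lemma O_additive_eq:
  fixes f :: "real \<Rightarrow> complex"
  assumes add: "\<And>x y. x \<in> \<O> \<Longrightarrow> y \<in> \<O> \<Longrightarrow> f (x + y) = f x + f y"
  obtains \<alpha> \<beta> where "\<And>x. x \<in> \<O> \<Longrightarrow> f x = \<alpha> * of_real x + \<beta> * of_real (\<sigma> x)"
proof -
  have f0: "f 0 = 0" using add[OF O_zero O_zero] by simp
  have f_nat: "f (of_nat n * x) = of_nat n * f x" if "x \<in> \<O>" for n x
    using that by (induction n) (auto simp: f0 distrib_right add O_mult O_of_nat)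
  have f_uminus: "f (- x) = - f x" if "x \<in> \<O>" for x
    using add[OF that O_uminus[OF that]] f0 by (simp add: eq_neg_iff_add_eq_0 add.commute)
  have f_int: "f (of_int n * x) = of_int n * f x" if "x \<in> \<O>" for n x
  proof (cases "n \<ge> 0")
    case True
    then show ?thesis using f_nat[OF that, of "nat n"] by simp
  next
    case False
    have "f (of_int n * x) = f (- (of_nat (nat (- n)) * x))" using False by simp
    also have "\<dots> = - (of_nat (nat (- n)) * f x)"
      by (subst f_uminus) (auto intro!: O_mult O_of_nat that simp: f_nat[OF that])
    also have "\<dots> = of_int n * f x" using False by simp
    finally show ?thesis .
  qed
  have ne: "complex_of_real (\<epsilon> - \<sigma> \<epsilon>) \<noteq> 0" using \<sigma>_\<epsilon>_neq by simp
  \<comment> \<open>Cramer's rule for the system f(1) = \<alpha> + \<beta>, f(\<epsilon>) = \<alpha>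
    \<epsilon> + \<beta> \<sigma>(\<epsilon>).\<close>
  define \<alpha> where "\<alpha> = (f \<epsilon> - of_real (\<sigma> \<epsilon>) * f 1) / of_real (\<epsilon> - \<sigma> \<epsilon>)"
  define \<beta> where "\<beta> = f 1 - \<alpha>"
  have "\<alpha> * of_real (\<epsilon> - \<sigma> \<epsilon>) = f \<epsilon> - of_real (\<sigma> \<epsilon>) * f 1"
    using ne by (simp add: \<alpha>_def)
  then have fe: "f \<epsilon> = \<alpha> * of_real \<epsilon> + \<beta> * of_real (\<sigma> \<epsilon>)"
    by (simp add: \<beta>_def algebra_simps)
  have f1: "f 1 = \<alpha> + \<beta>" by (simp add: \<beta>_def)
  show ?thesis
  proof (rule that)
    fix x assume x: "x \<in> \<O>"
    obtain p q where pq: "x = of_rat p + of_rat q * \<epsilon>"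
      using F_basis[OF O_F[OF \<epsilon>_O] \<epsilon>_irrational O_F[OF x]] by metis
    obtain a b where p: "p = of_int a / of_int b" "b > 0"
      by (metis quotient_of_div quotient_of_denom_pos surj_pair)
    obtain c d where q: "q = of_int c / of_int d" "d > 0"
      by (metis quotient_of_div quotient_of_denom_pos surj_pair)
    \<comment> \<open>\<open>b * d\<close> is a common denominator of the two rational coordinates
      of \<open>x\<close>.\<close>
    have dx: "of_int (b * d) * x = of_int (a * d) * 1 + of_int (b * c) * \<epsilon>"
    proof -
      have "real_of_rat p * of_int b = of_int a" "real_of_rat q * of_int d = of_int c"
        using p q by (simp_all add: of_rat_divide)
      moreover have "of_int (b * d) * x
          = of_int d * (real_of_rat p * of_int b) + of_int b * (real_of_rat q * of_int d) * \<epsilon>"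
        by (simp add: pq algebra_simps)
      ultimately show ?thesis by simp
    qed
    have "of_int (b * d) * f x = f (of_int (b * d) * x)" by (simp only: f_int[OF x])
    also have "\<dots> = of_int (a * d) * f 1 + of_int (b * c) * f \<epsilon>"
      unfolding dx by (simp only: add O_mult O_of_int O_one \<epsilon>_O f_int)
    finally have 1: "of_int (b * d) * f x = of_int (a * d) * f 1 + of_int (b * c) * f \<epsilon>" .
    have "\<sigma> (of_int (b * d) * x) = \<sigma> (of_int (a * d) * 1 + of_int (b * c) * \<epsilon>)"
      using dx by simp
    then have "of_int (b * d) * \<sigma> x = of_int (a * d) * \<sigma> 1 + of_int (b * c) * \<sigma> \<epsilon>"
      using x by (simp only: \<sigma>_add \<sigma>_mult \<sigma>_of_int F_mult F_of_int F_one O_F \<epsilon>_O)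
    then have dsx: "of_int (b * d) * \<sigma> x = of_int (a * d) + of_int (b * c) * \<sigma> \<epsilon>"
      by (simp only: \<sigma>_one mult_1_right)
    have dx': "complex_of_int (b * d) * of_real x = of_int (a * d) + of_int (b * c) * of_real \<epsilon>"
      using arg_cong[OF dx, of complex_of_real] by simp
    have dsx': "complex_of_int (b * d) * of_real (\<sigma> x) = of_int (a * d) + of_int (b * c) * of_real (\<sigma> \<epsilon>)"
      using arg_cong[OF dsx, of complex_of_real] by simp
    have "of_int (b * d) * (\<alpha> * of_real x + \<beta> * of_real (\<sigma> x))
        = \<alpha> * (of_int (b * d) * of_real x) + \<beta> * (of_int (b * d) * of_real (\<sigma> x))"
      by (simp only: algebra_simps)
    also have "\<dots> = of_int (b * d) * f x"
      unfolding 1 fe f1 dx' dsx' by (simp add: algebra_simps)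
    finally have "of_int (b * d) * f x = of_int (b * d) * (\<alpha> * of_real x + \<beta> * of_real (\<sigma> x))"
      by (rule sym)
    moreover have "complex_of_int (b * d) \<noteq> 0" using p q by simp
    ultimately show "f x = \<alpha> * of_real x + \<beta> * of_real (\<sigma> x)"
      using mult_left_cancel by blast
  qed
qed

end

section \<open>Symmetric powers and tensor products\<close>

lemma mat22_carrier [simp]: "mat22 a b c d \<in> carrier_mat 2 2"
  and mat22_index [simp]: "mat22 a b c d $$ (0, 0) = a" "mat22 a b c d $$ (0, Suc 0) = b"
    "mat22 a b c d $$ (Suc 0, 0) = c" "mat22 a b c d $$ (Suc 0, Suc 0) = d"
  and mat22_dim [simp]: "dim_row (mat22 a b c d) = 2" "dim_col (mat22 a b c d) = 2"
  by (auto simp: mat22_def mat_of_rows_list_def)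

lemma eq_mat22I:
  assumes "A \<in> carrier_mat 2 2" "A $$ (0, 0) = a" "A $$ (0, Suc 0) = b" "A $$ (Suc 0, 0) = c"
    "A $$ (Suc 0, Suc 0) = d"
  shows "A = mat22 a b c d"
  by (rule eq_matI) (use assms in \<open>auto simp: less_2_cases_iff\<close>)

lemma mat22_cases:
  assumes "A \<in> carrier_mat 2 2"
  obtains a b c d where "A = mat22 a b c d"
  using eq_mat22I[OF assms refl refl refl refl] by blast

lemma mat22_eq_iff [simp]:
  "mat22 a b c d = mat22 a' b' c' d' \<longleftrightarrow> a = a' \<and> b = b' \<and> c = c' \<and> d = d'"
  by (metis mat22_index)

lemma mat22_mult [simp]:
  fixes a b c d :: "'a :: comm_semiring_1"
  shows "mat22 a b c d * mat22 a' b' c' d' =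
    mat22 (a * a' + b * c') (a * b' + b * d') (c * a' + d * c') (c * b' + d * d')"
  by (rule eq_mat22I) (auto simp: scalar_prod_def numeral_2_eq_2)

lemma mat22_uminus [simp]:
  fixes a b c d :: "'a :: comm_ring_1"
  shows "- mat22 a b c d = mat22 (- a) (- b) (- c) (- d)"
  by (rule eq_mat22I) auto

lemma mat22_one: "1\<^sub>m 2 = mat22 1 0 0 1"
  by (rule eq_mat22I) auto

lemma mat22_map [simp]: "map_mat f (mat22 a b c d) = mat22 (f a) (f b) (f c) (f d)"
  by (rule eq_mat22I) auto

lemma mat22_det [simp]:
  fixes a b c d :: "'a :: comm_ring_1"
  shows "det (mat22 a b c d) = a * d - b * c"
proof -
  have "det (mat22 a b c d) = (\<Sum>j<2. mat22 a b c d $$ (0, j) * cofactor (mat22 a b c d) 0 j)"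
    by (rule laplace_expansion_row[OF mat22_carrier]) simp
  also have "\<dots> = a * cofactor (mat22 a b c d) 0 0 + b * cofactor (mat22 a b c d) 0 1"
    by (simp add: numeral_2_eq_2)
  also have "cofactor (mat22 a b c d) 0 0 = d"
    unfolding cofactor_def by (subst det_single) (auto simp: mat_delete_def)
  also have "cofactor (mat22 a b c d) 0 1 = - c"
    unfolding cofactor_def by (subst det_single) (auto simp: mat_delete_def)
  finally show ?thesis by simp
qed

lemma mat22_elements [simp]: "elements_mat (mat22 a b c d) = {a, b, c, d}"
  by (auto simp: elements_mat_def numeral_2_eq_2)

lemma sym_rep_carrier [simp]:
  assumes "g \<in> carrier_mat 2 2"
  shows "sym_rep l g \<in> carrier_mat (l + 1) (l + 1)"
  by (simp add: sym_rep_unique_eq(2)[OF assms])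

lemma sym_rep_monomial_vec:
  assumes "g \<in> carrier_mat 2 2"
  shows "sym_rep l g *\<^sub>v monomial_vec l u v =
    monomial_vec l ((g *\<^sub>v vec_of_list [u, v]) $ 0) ((g *\<^sub>v vec_of_list [u, v]) $ 1)"
  using theI'[OF sym_rep_unique_eq(1)[OF assms, of l]] unfolding sym_rep_def by blast

text \<open>The defining property determines the matrix, and on a vector of monomials both sides
  amount to substituting \<open>h\<close> first and \<open>g\<close> afterwards.\<close>

lemma sym_rep_mult:
  assumes g: "g \<in> carrier_mat 2 2" and h: "h \<in> carrier_mat 2 2"
  shows "sym_rep l (g * h) = sym_rep l g * sym_rep l h"
proof -
  have gh: "g * h \<in> carrier_mat 2 2" using g h by simp
  have "(sym_rep l g * sym_rep l h) *\<^sub>v monomial_vec l u v =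
      monomial_vec l ((g * h *\<^sub>v vec_of_list [u, v]) $ 0) ((g * h *\<^sub>v vec_of_list [u, v]) $ 1)" for u v
  proof -
    let ?w = "h *\<^sub>v vec_of_list [u, v]"
    have w: "vec_of_list [?w $ 0, ?w $ 1] = ?w"
      by (rule eq_vecI) (use h in \<open>auto simp: less_2_cases_iff numeral_2_eq_2 less_Suc_eq\<close>)
    have uv: "vec_of_list [u, v] \<in> carrier_vec 2"
      by (rule carrier_vecI) simp
    have mv: "monomial_vec l u v \<in> carrier_vec (l + 1)"
      by (simp add: monomial_vec_def)
    have "(sym_rep l g * sym_rep l h) *\<^sub>v monomial_vec l u v
        = sym_rep l g *\<^sub>v (sym_rep l h *\<^sub>v monomial_vec l u v)"
      using sym_rep_carrier[OF g, of l] sym_rep_carrier[OF h, of l] mv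
      by (rule assoc_mult_mat_vec)
    also have "\<dots> = monomial_vec l ((g *\<^sub>v ?w) $ 0) ((g *\<^sub>v ?w) $ 1)"
      by (simp only: sym_rep_monomial_vec[OF h] sym_rep_monomial_vec[OF g] w)
    also have "g *\<^sub>v ?w = g * h *\<^sub>v vec_of_list [u, v]"
      using g h uv by simp
    finally show ?thesis .
  qed
  moreover have "sym_rep l g * sym_rep l h \<in> carrier_mat (l + 1) (l + 1)"
    using sym_rep_carrier[OF g] sym_rep_carrier[OF h] by (rule mult_carrier_mat)
  ultimately show ?thesis
    using sym_rep_unique_eq(1)[OF gh, of l] sym_rep_carrier[OF gh, of l] sym_rep_monomial_vec[OF gh, of l]
    by blast
qed

text \<open>Entries are coefficients of products of \<open>l\<close> linear forms, each of which
  changes sign.\<close>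

lemma sym_rep_uminus:
  assumes g: "g \<in> carrier_mat 2 2"
  shows "sym_rep l (- g) = (- 1) ^ l \<cdot>\<^sub>m sym_rep l g"
proof -
  obtain a b c d where g: "g = mat22 a b c d" using assms by (rule mat22_cases)
  have neg: "[:- x, - y:] ^ k = smult ((- 1) ^ k) ([:x, y:] ^ k)" for x y :: complex and k
    using smult_power[of "- 1" "[:x, y:]" k] by simp
  have sgn: "(- 1) ^ (l - i) * (- 1) ^ i = ((- 1) ^ l :: complex)" if "i \<le> l" for i
    using that by (simp flip: power_add)
  have entry: "coeff ([:- a, - b:] ^ (l - i) * [:- c, - d:] ^ i) j
      = (- 1) ^ l * coeff ([:a, b:] ^ (l - i) * [:c, d:] ^ i) j" if "i \<le> l" for i j
  proof -
    have "[:- a, - b:] ^ (l - i) * [:- c, - d:] ^ i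
        = smult ((- 1) ^ (l - i) * (- 1) ^ i) ([:a, b:] ^ (l - i) * [:c, d:] ^ i)"
      unfolding neg by (simp only: mult_smult_left mult_smult_right smult_smult mult.commute)
    then show ?thesis by (simp only: sgn[OF that] coeff_smult)
  qed
  show ?thesis
    unfolding g sym_rep_unique_eq(2)[OF mat22_carrier] mat22_uminus
    by (rule eq_matI) (simp_all add: entry)
qed

text \<open>Row \<open>i\<close> lists the coefficients of u^(l-i) (c u + v)^i. For
  \<open>j > i\<close> the truncated exponent \<open>i - j\<close> is harmless, since the binomial
  coefficient is 0.\<close>

lemma sym_rep_unipotent_index:
  assumes "i \<le> l" "j \<le> l"
  shows "sym_rep l (mat22 1 0 c 1) $$ (i, j) = of_nat (i choose j) * c ^ (i - j)"
proof -
  have one: "[:1, 0:] = (1 :: complex poly)" by simp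
  have "coeff ([:c, 1:] ^ i) j = of_nat (i choose j) * c ^ (i - j)"
  proof (cases "j \<le> i")
    case False
    have "degree ([:c, 1:] ^ i) \<le> i" by (rule order.trans[OF degree_power_le]) simp
    then show ?thesis using False by (simp add: coeff_eq_0)
  qed (simp add: coeff_linear_poly_power)
  then show ?thesis
    unfolding sym_rep_unique_eq(2)[OF mat22_carrier] using assms by (simp add: one del: pCons_0_0)
qed

lemma sym_rep_diagonal_index:
  assumes "i \<le> l" "j \<le> l"
  shows "sym_rep l (mat22 a 0 0 d) $$ (i, j) = (if i = j then a ^ (l - i) * d ^ i else 0)"
proof -
  have "[:a, 0:] ^ (l - i) * [:0, d:] ^ i = monom (a ^ (l - i) * d ^ i) i"
  proof -
    have "[:a, 0:] = monom a 0" "[:0, d:] = monom d 1"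
      by (simp_all add: monom_0 monom_Suc)
    then show ?thesis by (simp only: monom_power mult_monom mult_0 add_0 nat_mult_1)
  qed
  then show ?thesis
    using assms by (simp add: sym_rep_unique_eq(2))
qed

section \<open>Tensor products in coordinates and the unipotent action\<close>

lemma tensor_space_iff:
  "v \<in> tensor_space m n \<longleftrightarrow> (\<forall>i j. \<not> (i \<le> m \<and> j \<le> n) \<longrightarrow> v (i, j) = 0)"
  by (simp add: tensor_space_def)

lemma tensor_space_add: "v \<in> tensor_space m n \<Longrightarrow> w \<in> tensor_space m n \<Longrightarrow> v + w \<in> tensor_space m n"
  and tensor_space_diff: "v \<in> tensor_space m n \<Longrightarrow> w \<in> tensor_space m n \<Longrightarrow> v - w \<in> tensor_space m n"
  and tensor_space_scale: "v \<in> tensor_space m n \<Longrightarrow> (\<lambda>i. z * v i) \<in> tensor_space m n"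
  and tensor_space_zero: "0 \<in> tensor_space m n"
  by (auto simp: tensor_space_iff)

lemma tensor_act_closed:
  "A \<in> carrier_mat (m + 1) p \<Longrightarrow> B \<in> carrier_mat (n + 1) q \<Longrightarrow> tensor_act A B v \<in> tensor_space m n"
  by (auto simp: tensor_space_iff tensor_act_def)

lemma tensor_act_add: "tensor_act A B (v + w) = tensor_act A B v + tensor_act A B w"
  by (rule ext) (auto simp: tensor_act_def algebra_simps sum.distrib)

lemma tensor_act_scale: "tensor_act A B (\<lambda>i. z * v i) = (\<lambda>i. z * tensor_act A B v i)"
  by (rule ext) (auto simp: tensor_act_def sum_distrib_left mult_ac intro!: sum.cong)

lemma tensor_act_smult:
  "tensor_act (x \<cdot>\<^sub>m A) (y \<cdot>\<^sub>m B) v = (\<lambda>i. x * y * tensor_act A B v i)"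
  by (rule ext) (auto simp: tensor_act_def sum_distrib_left mult_ac intro!: sum.cong)

lemma tensor_act_mult:
  assumes A: "A \<in> carrier_mat m p" and B: "B \<in> carrier_mat n q"
    and C: "C \<in> carrier_mat p r" and D: "D \<in> carrier_mat q s"
  shows "tensor_act A B (tensor_act C D v) = tensor_act (A * C) (B * D) v"
proof (rule ext, clarify)
  fix i j
  show "tensor_act A B (tensor_act C D v) (i, j) = tensor_act (A * C) (B * D) v (i, j)"
  proof (cases "i < m \<and> j < n")
    case False
    then show ?thesis using A B by (auto simp: tensor_act_def)
  next
    case True
    let ?t = "\<lambda>k l k' l'. A $$ (i, k) * C $$ (k, k') * (B $$ (j, l) * D $$ (l, l')) * v (k', l')"
    have "tensor_act A B (tensor_act C D v) (i, j) =
        (\<Sum>k<p. \<Sum>l<q. \<Sum>k'<r. \<Sum>l'<s. ?t k l k' l')"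
      using True A B C D
      by (auto simp: tensor_act_def sum_distrib_left mult_ac intro!: sum.cong)
    also have "\<dots> = (\<Sum>k<p. \<Sum>k'<r. \<Sum>l<q. \<Sum>l'<s. ?t k l k' l')"
      by (intro sum.cong refl sum.swap)
    also have "\<dots> = (\<Sum>k'<r. \<Sum>k<p. \<Sum>l<q. \<Sum>l'<s. ?t k l k' l')"
      by (rule sum.swap)
    also have "\<dots> = (\<Sum>k'<r. \<Sum>k<p. \<Sum>l'<s. \<Sum>l<q. ?t k l k' l')"
      by (intro sum.cong refl sum.swap)
    also have "\<dots> = (\<Sum>k'<r. \<Sum>l'<s. \<Sum>k<p. \<Sum>l<q. ?t k l k' l')"
      by (intro sum.cong refl sum.swap)
    also have "\<dots> = (\<Sum>k'<r. \<Sum>l'<s. (A * C) $$ (i, k') * (B * D) $$ (j, l') * v (k', l'))"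
    proof (intro sum.cong refl)
      fix k' l' assume "k' \<in> {..<r}" "l' \<in> {..<s}"
      then have "(A * C) $$ (i, k') = (\<Sum>k<p. A $$ (i, k) * C $$ (k, k'))"
        "(B * D) $$ (j, l') = (\<Sum>l<q. B $$ (j, l) * D $$ (l, l'))"
        using True A B C D by (auto simp: scalar_prod_def atLeast0LessThan)
      then show "(\<Sum>k<p. \<Sum>l<q. ?t k l k' l') = (A * C) $$ (i, k') * (B * D) $$ (j, l') * v (k', l')"
        by (simp only: sum_distrib_left sum_distrib_right) (rule sum.swap)
    qed
    also have "\<dots> = tensor_act (A * C) (B * D) v (i, j)"
      using True A B C D by (auto simp: tensor_act_def)
    finally show ?thesis .
  qed
qed

text \<open>Multiplication by exp(a X + b Y) with independent parameters \<open>a\<close> and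
  \<open>b\<close>; the arithmetic relation between them enters only when they are specialized to x
  and \<sigma>(x).\<close>

definition unip :: "nat \<Rightarrow> nat \<Rightarrow> complex \<Rightarrow> complex \<Rightarrow> (nat \<times> nat \<Rightarrow> complex) \<Rightarrow> nat \<times> nat \<Rightarrow> complex" where
  "unip m n a b = tensor_act (sym_rep m (mat22 1 0 a 1)) (sym_rep n (mat22 1 0 b 1))"

lemma unip_index:
  assumes "i \<le> m" "j \<le> n"
  shows "unip m n a b v (i, j) = (\<Sum>k\<le>i. \<Sum>l\<le>j.
    of_nat (i choose k) * a ^ (i - k) * (of_nat (j choose l) * b ^ (j - l)) * v (k, l))"
proof -
  have "unip m n a b v (i, j) = (\<Sum>k\<le>m. \<Sum>l\<le>n.
      of_nat (i choose k) * a ^ (i - k) * (of_nat (j choose l) * b ^ (j - l)) * v (k, l))"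
    using assms sym_rep_carrier[OF mat22_carrier, of m 1 0 a 1] sym_rep_carrier[OF mat22_carrier, of n 1 0 b 1]
    by (auto simp: unip_def tensor_act_def lessThan_Suc_atMost sym_rep_unipotent_index intro!: sum.cong)
  also have "\<dots> = (\<Sum>k\<le>i. \<Sum>l\<le>n.
      of_nat (i choose k) * a ^ (i - k) * (of_nat (j choose l) * b ^ (j - l)) * v (k, l))"
    using assms by (intro sum.mono_neutral_right) (auto simp: binomial_eq_0)
  also have "\<dots> = (\<Sum>k\<le>i. \<Sum>l\<le>j.
      of_nat (i choose k) * a ^ (i - k) * (of_nat (j choose l) * b ^ (j - l)) * v (k, l))"
    using assms by (intro sum.cong refl sum.mono_neutral_right) (auto simp: binomial_eq_0)
  finally show ?thesis .
qed

lemma unip_closed: "unip m n a b v \<in> tensor_space m n"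
  unfolding unip_def by (rule tensor_act_closed[OF sym_rep_carrier sym_rep_carrier]) simp_all

lemma unip_unip: "unip m n a b (unip m n c d v) = unip m n (a + c) (b + d) v"
  unfolding unip_def
  by (subst tensor_act_mult[OF sym_rep_carrier sym_rep_carrier sym_rep_carrier sym_rep_carrier])
     (simp_all add: sym_rep_mult[symmetric])

lemma unip_add: "unip m n a b (v + w) = unip m n a b v + unip m n a b w"
  unfolding unip_def by (rule tensor_act_add)

lemma unip_scale: "unip m n a b (\<lambda>i. z * v i) = (\<lambda>i. z * unip m n a b v i)"
  unfolding unip_def by (rule tensor_act_scale)

section \<open>Cocycles of the unipotent group\<close>

lemma unip_index_pairs:
  assumes "i \<le> m" "j \<le> n"
  shows "unip m n a b v (i, j) = (\<Sum>(k, l)\<in>{..i} \<times> {..j}.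
    of_nat (i choose k) * a ^ (i - k) * (of_nat (j choose l) * b ^ (j - l)) * v (k, l))"
  by (simp add: unip_index[OF assms] sum.cartesian_product)

text \<open>Apart from the identity, \<open>unip\<close> only contributes to higher total degree:
  every other index pair in the box below (i, j) has degree less than \<open>d\<close>.\<close>

lemma unip_low_degree:
  assumes "i \<le> m" "j \<le> n" "i + j \<le> d" and low: "\<And>k l. k + l < d \<Longrightarrow> w (k, l) = 0"
  shows "unip m n a b w (i, j) = w (i, j)"
proof -
  have "unip m n a b w (i, j) = (\<Sum>(k, l)\<in>{(i, j)}.
      of_nat (i choose k) * a ^ (i - k) * (of_nat (j choose l) * b ^ (j - l)) * w (k, l))"
    unfolding unip_index_pairs[OF assms(1,2)] using assms(3)
    by (intro sum.mono_neutral_right) (auto intro!: low)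
  then show ?thesis by simp
qed

text \<open>This is the first-order part 1 + (a X + b Y) of the exponential: one degree above the
  lowest, only \<open>w\<close> and its degree \<open>d\<close> part times a X + b Y
  survive.\<close>

lemma unip_next_degree:
  assumes "i \<le> m" "j \<le> n" "i + j = Suc d" and low: "\<And>k l. k + l < d \<Longrightarrow> w (k, l) = 0"
  shows "unip m n a b w (i, j) = w (i, j) + of_nat i * a * w (i - 1, j) + of_nat j * b * w (i, j - 1)"
proof -
  \<comment> \<open>For \<open>i = 0\<close> truncated subtraction would make
    \<open>(i - 1, j)\<close> the point \<open>(i, j)\<close> again, hence the guards. The stated
    formula agrees, as its factor \<open>of_nat i\<close> is then 0.\<close>
  define T where "T = {(i, j)} \<union> (if i > 0 then {(i - 1, j)} else {}) \<union> (if j > 0 then {(i, j - 1)} else {})"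
  have "unip m n a b w (i, j) = (\<Sum>(k, l)\<in>T.
      of_nat (i choose k) * a ^ (i - k) * (of_nat (j choose l) * b ^ (j - l)) * w (k, l))"
    unfolding unip_index_pairs[OF assms(1,2)]
  proof (intro sum.mono_neutral_right)
    show "\<forall>p\<in>{..i} \<times> {..j} - T. (case p of (k, l) \<Rightarrow>
        of_nat (i choose k) * a ^ (i - k) * (of_nat (j choose l) * b ^ (j - l)) * w (k, l)) = 0"
    proof (clarify)
      fix k l assume kl: "k \<le> i" "l \<le> j" "(k, l) \<notin> T"
      have "k + l < d"
      proof (rule ccontr)
        assume "\<not> k + l < d"
        then have "(k = i \<and> l = j) \<or> (i > 0 \<and> k = i - 1 \<and> l = j) \<or> (j > 0 \<and> k = i \<and> l = j - 1)"
          using kl(1,2) assms(3) by presburger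
        with kl(3) show False by (auto simp: T_def)
      qed
      then show "of_nat (i choose k) * a ^ (i - k) * (of_nat (j choose l) * b ^ (j - l)) * w (k, l) = 0"
        by (simp add: low)
    qed
  qed (auto simp: T_def)
  also have "\<dots> = w (i, j) + of_nat i * a * w (i - 1, j) + of_nat j * b * w (i, j - 1)"
    by (cases i; cases j) (auto simp: T_def)
  finally show ?thesis .
qed

text \<open>The binomial expansion of (a + s)^i integrated over s from 0 to b. It is the coordinate
  form of the cocycle identity for (exp(x X) - 1)/X.\<close>

lemma binomial_integral_sum:
  fixes a b :: complex
  shows "(\<Sum>k\<le>i. of_nat (i choose k) * a ^ (i - k) * (b ^ (k + 1) / of_nat (k + 1)))
    = ((a + b) ^ (i + 1) - a ^ (i + 1)) / of_nat (i + 1)"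
proof -
  have "(a + b) ^ (i + 1) = (b + a) ^ Suc i" by (simp add: add.commute)
  also have "\<dots> = (\<Sum>k\<le>Suc i. of_nat (Suc i choose k) * b ^ k * a ^ (Suc i - k))"
    by (rule binomial_ring)
  also have "\<dots> = a ^ (i + 1) + (\<Sum>k\<le>i. of_nat (Suc i choose Suc k) * b ^ Suc k * a ^ (i - k))"
    by (subst sum.atMost_Suc_shift) simp
  also have "(\<Sum>k\<le>i. of_nat (Suc i choose Suc k) * b ^ Suc k * a ^ (i - k))
      = of_nat (i + 1) * (\<Sum>k\<le>i. of_nat (i choose k) * a ^ (i - k) * (b ^ (k + 1) / of_nat (k + 1)))"
    unfolding sum_distrib_left
  proof (rule sum.cong[OF refl])
    fix k
    \<comment> \<open>Absorption identity for binomial coefficients; its quotient form plays the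
      part of integrating a monomial.\<close>
    have "of_nat (Suc i) * of_nat (i choose k) = (of_nat (Suc i choose Suc k) * of_nat (Suc k) :: complex)"
      by (simp only: Suc_times_binomial_eq flip: of_nat_mult)
    then have "of_nat (Suc i choose Suc k) = (of_nat (Suc i) * of_nat (i choose k) / of_nat (Suc k) :: complex)"
      by (simp del: of_nat_Suc add: eq_divide_eq)
    then show "of_nat (Suc i choose Suc k) * b ^ Suc k * a ^ (i - k)
      = of_nat (i + 1) * (of_nat (i choose k) * a ^ (i - k) * (b ^ (k + 1) / of_nat (k + 1)))"
      by (simp del: of_nat_Suc power_Suc)
  qed
  finally show ?thesis by (simp del: of_nat_Suc of_nat_add add: eq_divide_eq)
qed

text \<open>For fixed \<open>x\<close> the equation is a polynomial identity in \<open>k\<close>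
  valid at all naturals, so the coefficients of k agree: \<open>\<alpha> * s x = t x * c\<close>
  with \<open>c\<close> independent of \<open>x\<close>. Two points at which (s, t) are not
  proportional then leave only \<alpha> = 0.\<close>

lemma vanishing_linear_coeff:
  fixes \<alpha> :: complex and s t :: "'a \<Rightarrow> complex"
  assumes eq: "\<And>x k. x \<in> {x\<^sub>1, x\<^sub>2} \<Longrightarrow>
      \<alpha> * (of_nat k * s x) = (\<Sum>l<n. w l * (of_nat k * t x) ^ (n - l))"
    and st: "s x\<^sub>1 * t x\<^sub>2 \<noteq> s x\<^sub>2 * t x\<^sub>1"
  shows "\<alpha> = 0"
proof -
  \<comment> \<open>This is \<open>w (n - 1)\<close>, or 0 when \<open>n = 0\<close> and the sum is
    empty.\<close>
  define c where "c = (\<Sum>l<n. if n - l = 1 then w l else 0)"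
  have lin: "\<alpha> * s x = t x * c" if x: "x \<in> {x\<^sub>1, x\<^sub>2}" for x
  proof -
    define p where "p = monom (\<alpha> * s x) 1 - (\<Sum>l<n. monom (w l * t x ^ (n - l)) (n - l))"
    have "poly p (of_nat k) = 0" for k
    proof -
      have "poly p (of_nat k) = \<alpha> * (of_nat k * s x) - (\<Sum>l<n. w l * (of_nat k * t x) ^ (n - l))"
        by (simp add: p_def poly_monom poly_sum power_mult_distrib mult_ac)
      then show ?thesis using eq[OF x, of k] by simp
    qed
    then have "range of_nat \<subseteq> {z. poly p z = 0}" by auto
    then have "infinite {z. poly p z = 0}"
      by (rule infinite_super) (simp add: range_inj_infinite inj_on_def)
    then have "p = 0" using poly_roots_finite by blast
    then have "coeff p 1 = 0" by simp
    then have "\<alpha> * s x = (\<Sum>l<n. if n - l = 1 then w l * t x ^ (n - l) else 0)"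
      by (simp add: p_def coeff_sum)
    also have "\<dots> = t x * c"
      unfolding c_def sum_distrib_left by (rule sum.cong) auto
    finally show ?thesis .
  qed
  have "\<alpha> * (s x\<^sub>1 * t x\<^sub>2 - s x\<^sub>2 * t x\<^sub>1) = (\<alpha> * s x\<^sub>1) * t x\<^sub>2 - (\<alpha> * s x\<^sub>2) * t x\<^sub>1"
    by (simp add: algebra_simps)
  also have "\<dots> = 0" by (simp add: lin)
  finally show ?thesis using st by simp
qed

section \<open>Cocycles on the additive group of integers of F\<close>

locale unipotent_cocycles = real_quadratic F \<sigma> \<epsilon> for F \<sigma> \<epsilon> +
  fixes m n :: nat
begin

definition act :: "real \<Rightarrow> (nat \<times> nat \<Rightarrow> complex) \<Rightarrow> nat \<times> nat \<Rightarrow> complex" where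
  "act x = unip m n (of_real x) (of_real (\<sigma> x))"

text \<open>Cocycles of U in the additive coordinate. Values outside the integers are left free,
  unlike those of the extensional cochains in \<open>cocycles1\<close>.\<close>

definition cocycle :: "(real \<Rightarrow> nat \<times> nat \<Rightarrow> complex) \<Rightarrow> bool" where
  "cocycle f \<longleftrightarrow> (\<forall>x\<in>\<O>. f x \<in> tensor_space m n) \<and>
     (\<forall>x\<in>\<O>. \<forall>y\<in>\<O>. f (x + y) = f x + act x (f y))"

text \<open>Under \<open>e\<^sub>i \<otimes> e\<^sub>j \<leftrightarrow> X\<^sup>i Y\<^sup>j / (i! j!)\<close> the element \<open>x\<close> acts on
  \<open>\<complex>[X, Y]/(X\<^bsup>m+1\<^esup>, Y\<^bsup>n+1\<^esup>)\<close> as multiplication by \<open>exp(x X + \<sigma>(x) Y)\<close>; up to scaling the two cocycles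
  below are \<open>Y\<^sup>n (exp(x X) - 1)/X\<close> and \<open>X\<^sup>m (exp(\<sigma>(x) Y) - 1)/Y\<close>.\<close>

definition z1 :: "real \<Rightarrow> nat \<times> nat \<Rightarrow> complex" where
  "z1 x = (\<lambda>(i, j). if i \<le> m \<and> j = n then of_real x ^ (i + 1) / of_nat (i + 1) else 0)"

definition z2 :: "real \<Rightarrow> nat \<times> nat \<Rightarrow> complex" where
  "z2 x = (\<lambda>(i, j). if i = m \<and> j \<le> n then of_real (\<sigma> x) ^ (j + 1) / of_nat (j + 1) else 0)"

lemma act_closed: "act x v \<in> tensor_space m n"
  unfolding act_def by (rule unip_closed)

lemma act_act: "x \<in> \<O> \<Longrightarrow> y \<in> \<O> \<Longrightarrow> act x (act y v) = act (x + y) v"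
  by (simp add: act_def unip_unip \<sigma>_add O_F)

lemma act_add: "act x (v + w) = act x v + act x w"
  and act_scale: "act x (\<lambda>i. z * v i) = (\<lambda>i. z * act x v i)"
  by (simp_all add: act_def unip_add unip_scale)

lemma act_diff: "act x (v - w) = act x v - act x w"
  using act_add[of x "v - w" w] by (simp add: algebra_simps)

lemma cocycle_add:
  assumes "cocycle f" "cocycle h"
  shows "cocycle (\<lambda>x. f x + h x)"
  using assms by (simp add: cocycle_def act_add tensor_space_add algebra_simps)

lemma cocycle_scale:
  assumes "cocycle f"
  shows "cocycle (\<lambda>x i. z * f x i)"
  using assms by (simp add: cocycle_def act_scale tensor_space_scale fun_eq_iff distrib_left)

lemma cocycle_diff:
  assumes "cocycle f" "cocycle h"
  shows "cocycle (\<lambda>x. f x - h x)"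
  using assms by (simp add: cocycle_def act_diff tensor_space_diff algebra_simps)

lemma cocycle_coboundary:
  assumes "v \<in> tensor_space m n"
  shows "cocycle (\<lambda>x. act x v - v)"
  using assms by (simp add: cocycle_def act_diff act_act tensor_space_diff act_closed)

text \<open>Y annihilates Y^n, so only the factor exp(x X) acts on the row \<open>j = n\<close>, and
  the identity becomes \<open>binomial_integral_sum\<close> with a = x and b = y.\<close>

lemma cocycle_z1: "cocycle z1"
  unfolding cocycle_def
proof (intro conjI ballI)
  show "z1 x \<in> tensor_space m n" for x by (auto simp: z1_def tensor_space_iff)
  fix x y assume xy: "x \<in> \<O>" "y \<in> \<O>"
  show "z1 (x + y) = z1 x + act x (z1 y)"
  proof (rule ext, clarify)
    fix i j
    show "z1 (x + y) (i, j) = (z1 x + act x (z1 y)) (i, j)"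
    proof (cases "i \<le> m \<and> j \<le> n")
      case False
      then show ?thesis
        using act_closed[of x "z1 y"] by (auto simp: z1_def tensor_space_iff)
    next
      case ij: True
      have "act x (z1 y) (i, j) = (\<Sum>k\<le>i. \<Sum>l\<le>j. of_nat (i choose k) * of_real x ^ (i - k) *
          (of_nat (j choose l) * of_real (\<sigma> x) ^ (j - l)) * z1 y (k, l))"
        using ij by (simp add: act_def unip_index)
      also have "\<dots> = (\<Sum>k\<le>i. \<Sum>l\<le>j. if l = j \<and> j = n
          then of_nat (i choose k) * of_real x ^ (i - k) * (of_real y ^ (k + 1) / of_nat (k + 1)) else 0)"
        using ij by (intro sum.cong refl) (auto simp: z1_def)
      also have "\<dots> = (if j = n then (\<Sum>k\<le>i. of_nat (i choose k) * of_real x ^ (i - k)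
          * (of_real y ^ (k + 1) / of_nat (k + 1))) else 0)"
        by (auto simp: sum.delta)
      finally show ?thesis
        using ij unfolding binomial_integral_sum
        by (auto simp: z1_def diff_divide_distrib simp del: of_nat_Suc)
    qed
  qed
qed

lemma cocycle_z2: "cocycle z2"
  unfolding cocycle_def
proof (intro conjI ballI)
  show "z2 x \<in> tensor_space m n" for x by (auto simp: z2_def tensor_space_iff)
  fix x y assume xy: "x \<in> \<O>" "y \<in> \<O>"
  show "z2 (x + y) = z2 x + act x (z2 y)"
  proof (rule ext, clarify)
    fix i j
    show "z2 (x + y) (i, j) = (z2 x + act x (z2 y)) (i, j)"
    proof (cases "i \<le> m \<and> j \<le> n")
      case False
      then show ?thesis
        using act_closed[of x "z2 y"] by (auto simp: z2_def tensor_space_iff)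
    next
      case ij: True
      have "act x (z2 y) (i, j) = (\<Sum>k\<le>i. \<Sum>l\<le>j. of_nat (i choose k) * of_real x ^ (i - k) *
          (of_nat (j choose l) * of_real (\<sigma> x) ^ (j - l)) * z2 y (k, l))"
        using ij by (simp add: act_def unip_index)
      also have "\<dots> = (\<Sum>k\<le>i. if k = i then (\<Sum>l\<le>j. if i = m
          then of_nat (j choose l) * of_real (\<sigma> x) ^ (j - l) * (of_real (\<sigma> y) ^ (l + 1) / of_nat (l + 1))
          else 0) else 0)"
        using ij by (intro sum.cong refl) (auto simp: z2_def intro!: sum.cong sum.neutral)
      also have "\<dots> = (if i = m then (\<Sum>l\<le>j. of_nat (j choose l) * of_real (\<sigma> x) ^ (j - l)
          * (of_real (\<sigma> y) ^ (l + 1) / of_nat (l + 1))) else 0)"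
        by (auto simp: sum.delta)
      finally show ?thesis
        using ij xy unfolding binomial_integral_sum
        by (auto simp: z2_def diff_divide_distrib \<sigma>_add O_F simp del: of_nat_Suc)
    qed
  qed
qed

text \<open>The lowest nonzero homogeneous part of a cocycle is \<open>x \<mapsto> x g + \<sigma>(x) h\<close>; commutativity of
  \<open>\<O>\<close> forces \<open>X h = Y g\<close>, so that \<open>(g, h) = (X v, Y v)\<close> up to multiples of the corners
  \<open>Y\<^sup>n\<close> of \<open>g\<close> and \<open>X\<^sup>m\<close> of \<open>h\<close>.\<close>

lemma cocycle_lowest_degree:
  assumes f: "cocycle f" and low: "\<And>x i j. x \<in> \<O> \<Longrightarrow> i + j < d \<Longrightarrow> f x (i, j) = 0"
  obtains v \<alpha> \<beta> where "v \<in> tensor_space m n"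
    and "\<And>x i j. x \<in> \<O> \<Longrightarrow> i \<le> m \<Longrightarrow> j \<le> n \<Longrightarrow> i + j \<le> d \<Longrightarrow>
      f x (i, j) = act x v (i, j) - v (i, j) + \<alpha> * z1 x (i, j) + \<beta> * z2 x (i, j)"
proof -
  have f_add: "f (x + y) = f x + act x (f y)" if "x \<in> \<O>" "y \<in> \<O>" for x y
    using f that by (simp add: cocycle_def)
  \<comment> \<open>In the lowest degree the action is trivial, so each coordinate of
    \<open>f\<close> is additive there.\<close>
  have "\<exists>\<alpha> \<beta>. \<forall>x\<in>\<O>. f x (i, j) = \<alpha> * of_real x + \<beta> * of_real (\<sigma> x)"
    if "i \<le> m" "j \<le> n" "i + j = d" for i j
  proof -
    have "f (x + y) (i, j) = f x (i, j) + f y (i, j)" if "x \<in> \<O>" "y \<in> \<O>" for x y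
      using unip_low_degree[of i m j n d "f y"] low that \<open>i \<le> m\<close> \<open>j \<le> n\<close> \<open>i + j = d\<close>
      by (simp add: f_add act_def)
    then show ?thesis using O_additive_eq[of "\<lambda>x. f x (i, j)"] by metis
  qed
  then obtain g h where gh: "\<And>i j x. i \<le> m \<Longrightarrow> j \<le> n \<Longrightarrow> i + j = d \<Longrightarrow> x \<in> \<O> \<Longrightarrow>
      f x (i, j) = g i j * of_real x + h i j * of_real (\<sigma> x)"
    by metis
  \<comment> \<open>X h = Y g in coordinates, from comparing degree d + 1 of f(1 + \<epsilon>)
    expanded in both orders. The terms with X g and Y h cancel, and the rest has the nonzero factor
    \<sigma>(\<epsilon>) - \<epsilon>.\<close>
  have comm: "of_nat i * h (i - 1) j = of_nat j * g i (j - 1)"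
    if ij: "i \<le> m" "j \<le> n" "i + j = Suc d" for i j
  proof -
    have "f 1 + act 1 (f \<epsilon>) = f \<epsilon> + act \<epsilon> (f 1)"
      by (simp flip: f_add add: O_one \<epsilon>_O add.commute)
    then have "(f 1 + act 1 (f \<epsilon>)) (i, j) = (f \<epsilon> + act \<epsilon> (f 1)) (i, j)" by simp
    then have 1: "of_nat i * f \<epsilon> (i - 1, j) + of_nat j * f \<epsilon> (i, j - 1) =
        of_nat i * (of_real \<epsilon> * f 1 (i - 1, j)) + of_nat j * (of_real (\<sigma> \<epsilon>) * f 1 (i, j - 1))"
      using unip_next_degree[OF ij, of "f \<epsilon>"] unip_next_degree[OF ij, of "f 1"] low O_one \<epsilon>_O
      by (simp add: act_def \<sigma>_one mult.assoc)
    have i: "of_nat i * f x (i - 1, j) = of_nat i * (g (i - 1) j * of_real x + h (i - 1) j * of_real (\<sigma> x))"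
      if "x \<in> \<O>" for x
      using gh[of "i - 1" j x] ij that by (cases "i = 0") auto
    have j: "of_nat j * f x (i, j - 1) = of_nat j * (g i (j - 1) * of_real x + h i (j - 1) * of_real (\<sigma> x))"
      if "x \<in> \<O>" for x
      using gh[of i "j - 1" x] ij that by (cases "j = 0") auto
    have "of_nat i * f \<epsilon> (i - 1, j) + of_nat j * f \<epsilon> (i, j - 1) =
        of_real \<epsilon> * (of_nat i * f 1 (i - 1, j)) + of_real (\<sigma> \<epsilon>) * (of_nat j * f 1 (i, j - 1))"
      using 1 by (simp add: mult_ac)
    then have "(of_nat i * h (i - 1) j - of_nat j * g i (j - 1)) * (of_real (\<sigma> \<epsilon>) - of_real \<epsilon>) = 0"
      unfolding i[OF \<epsilon>_O] i[OF O_one] j[OF \<epsilon>_O] j[OF O_one] \<sigma>_one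
      by (simp add: algebra_simps)
    then show ?thesis using \<sigma>_\<epsilon>_neq by simp
  qed
  \<comment> \<open>Solve X v = g by dividing by \<open>i + 1\<close>. In the last row
    \<open>i = m\<close> there is no entry of \<open>g\<close> to divide, so Y v = h is solved
    instead; at the corner (m, n) neither equation constrains \<open>v\<close>.\<close>
  define v where "v = (\<lambda>(i, j). if i \<le> m \<and> j \<le> n \<and> i + j + 1 = d then
      if i < m then g (i + 1) j / of_nat (i + 1) else if j < n then h m (j + 1) / of_nat (j + 1) else 0
      else 0)"
  have vV: "v \<in> tensor_space m n"
    by (auto simp: v_def tensor_space_iff)
  have vlow: "v (k, l) = 0" if "k + l < d - 1" for k l
    using that by (auto simp: v_def)
  \<comment> \<open>X v has no entry at i = 0, and \<open>comm\<close> forces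
    \<open>g 0 j = 0\<close> for \<open>j < n\<close>; only (0, n) is left over, and it has degree d
    exactly when \<open>d = n\<close>. The default 0 keeps \<open>z1\<close> from disturbing other
    degrees. The entry (m, 0) of \<open>h\<close> is treated alike.\<close>
  define \<alpha> where "\<alpha> = (if d = n then g 0 n else 0)"
  define \<beta> where "\<beta> = (if d = m then h m 0 else 0)"
  have g_eq: "g i j = of_nat i * v (i - 1, j) + (if i = 0 \<and> j = n then \<alpha> else 0)"
    if ij: "i \<le> m" "j \<le> n" "i + j = d" for i j
  proof (cases "i = 0")
    case True
    then show ?thesis using comm[of 0 "Suc j"] ij
      by (cases "j = n") (auto simp: \<alpha>_def simp del: of_nat_Suc)
  next
    case False
    then show ?thesis using ij by (cases i) (auto simp: v_def simp del: of_nat_Suc)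
  qed
  have h_eq: "h i j = of_nat j * v (i, j - 1) + (if i = m \<and> j = 0 then \<beta> else 0)"
    if ij: "i \<le> m" "j \<le> n" "i + j = d" for i j
  proof (cases "j = 0")
    case True
    then show ?thesis using comm[of "Suc i" 0] ij
      by (cases "i = m") (auto simp: \<beta>_def simp del: of_nat_Suc)
  next
    case False
    show ?thesis
    proof (cases "i = m")
      case True
      then show ?thesis using False ij by (simp add: v_def)
    next
      case im: False
      then have "of_nat (Suc i) * h i j = of_nat j * g (Suc i) (j - 1)"
        using comm[of "Suc i" j] ij False by simp
      then have "h i j = of_nat j * (g (Suc i) (j - 1) / of_nat (Suc i))"
        by (simp add: eq_divide_eq mult.commute del: of_nat_Suc)
      then show ?thesis using im False ij by (simp add: v_def)
    qed
  qed
  show ?thesis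
  proof (rule that[OF vV])
    fix x i j assume x: "x \<in> \<O>" and ij: "i \<le> m" "j \<le> n" "i + j \<le> d"
    \<comment> \<open>The first-order formula needs a predecessor of \<open>d\<close>, so d = 0 is
      separate: there v = 0, and any contribution comes from the two corner cocycles.\<close>
    consider "i + j < d" | "i + j = d" "d = 0" | d' where "i + j = d" "d = Suc d'"
      using ij(3) by (cases d) (auto simp: order_le_less)
    then show "f x (i, j) = act x v (i, j) - v (i, j) + \<alpha> * z1 x (i, j) + \<beta> * z2 x (i, j)"
    proof cases
      case 1
      then have "act x v (i, j) = v (i, j)"
        unfolding act_def using ij vlow by (intro unip_low_degree[where d = "d - 1"]) auto
      moreover have "\<alpha> * z1 x (i, j) = 0" "\<beta> * z2 x (i, j) = 0"
        using 1 by (auto simp: \<alpha>_def \<beta>_def z1_def z2_def)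
      ultimately show ?thesis using low[OF x 1] by (simp only: diff_self add_0)
    next
      case 2
      then have "v = 0" by (auto simp: v_def)
      then have v0: "act x v (i, j) = 0" "v (i, j) = 0"
        using act_diff[of x 0 0] by auto
      have "z1 x (0, 0) = (if n = 0 then of_real x else 0)" "z2 x (0, 0) = (if m = 0 then of_real (\<sigma> x) else 0)"
        by (auto simp: z1_def z2_def)
      then show ?thesis
        using 2 gh[OF ij(1,2) 2(1) x] g_eq[OF ij(1,2) 2(1)] h_eq[OF ij(1,2) 2(1)] v0 by auto
    next
      case 3
      have a: "act x v (i, j) = v (i, j) + of_nat i * of_real x * v (i - 1, j)
          + of_nat j * of_real (\<sigma> x) * v (i, j - 1)"
        unfolding act_def using 3 ij vlow by (intro unip_next_degree[where d = d']) auto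
      have b: "\<alpha> * z1 x (i, j) = (if i = 0 \<and> j = n then \<alpha> else 0) * of_real x"
        using 3 by (auto simp: \<alpha>_def z1_def)
      have c: "\<beta> * z2 x (i, j) = (if i = m \<and> j = 0 then \<beta> else 0) * of_real (\<sigma> x)"
        using 3 by (auto simp: \<beta>_def z2_def)
      show ?thesis
        unfolding a b c gh[OF ij(1,2) 3(1) x] g_eq[OF ij(1,2) 3(1)] h_eq[OF ij(1,2) 3(1)]
        by (simp add: algebra_simps)
    qed
  qed
qed

lemma cocycle_eq_below_degree:
  assumes f: "cocycle f"
  shows "\<exists>v\<in>tensor_space m n. \<exists>\<alpha> \<beta>. \<forall>x\<in>\<O>. \<forall>i j. i + j < d \<longrightarrow>
    f x (i, j) = act x v (i, j) - v (i, j) + \<alpha> * z1 x (i, j) + \<beta> * z2 x (i, j)"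
proof (induction d)
  case 0
  show ?case using tensor_space_zero by auto
next
  case (Suc d)
  then obtain v \<alpha> \<beta> where v: "v \<in> tensor_space m n" and eq: "\<And>x i j. x \<in> \<O> \<Longrightarrow> i + j < d \<Longrightarrow>
      f x (i, j) = act x v (i, j) - v (i, j) + \<alpha> * z1 x (i, j) + \<beta> * z2 x (i, j)"
    by blast
  \<comment> \<open>The part not yet matched; it is again a cocycle and vanishes below degree
    \<open>d\<close>, and what its lowest part needs is added to \<open>v\<close>, \<alpha> and
    \<beta>.\<close>
  define f' where "f' = (\<lambda>x. f x - ((act x v - v) + (\<lambda>i. \<alpha> * z1 x i) + (\<lambda>i. \<beta> * z2 x i)))"
  have f': "cocycle f'"
    unfolding f'_def
    by (intro cocycle_diff cocycle_add cocycle_scale cocycle_coboundary f v cocycle_z1 cocycle_z2)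
  have low: "f' x (i, j) = 0" if "x \<in> \<O>" "i + j < d" for x i j
    using eq[OF that] by (simp add: f'_def)
  obtain w \<gamma> \<delta> where w: "w \<in> tensor_space m n"
    and eq': "\<And>x i j. x \<in> \<O> \<Longrightarrow> i \<le> m \<Longrightarrow> j \<le> n \<Longrightarrow> i + j \<le> d \<Longrightarrow>
      f' x (i, j) = act x w (i, j) - w (i, j) + \<gamma> * z1 x (i, j) + \<delta> * z2 x (i, j)"
    using cocycle_lowest_degree[OF f' low] by blast
  have "f x (i, j) = act x (v + w) (i, j) - (v + w) (i, j) + (\<alpha> + \<gamma>) * z1 x (i, j) + (\<beta> + \<delta>) * z2 x (i, j)"
    if "x \<in> \<O>" "i + j < Suc d" for x i j
  proof (cases "i \<le> m \<and> j \<le> n")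
    case True
    then show ?thesis
      using eq'[of x i j] that by (simp add: f'_def act_add algebra_simps)
  next
    case False
    then show ?thesis
      using f \<open>x \<in> \<O>\<close> act_closed[of x "v + w"] tensor_space_add[OF v w]
      by (auto simp: cocycle_def tensor_space_iff z1_def z2_def)
  qed
  then show ?case using tensor_space_add[OF v w] by blast
qed

lemma cocycle_decompose:
  assumes f: "cocycle f"
  obtains v \<alpha> \<beta> where "v \<in> tensor_space m n"
    and "\<And>x. x \<in> \<O> \<Longrightarrow> f x = (act x v - v) + (\<lambda>i. \<alpha> * z1 x i) + (\<lambda>i. \<beta> * z2 x i)"
proof -
  \<comment> \<open>The bound m + n + 1 exceeds the total degree of every index pair with i \<le> m
    and j \<le> n.\<close>
  obtain v \<alpha> \<beta> where v: "v \<in> tensor_space m n"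
    and eq: "\<And>x i j. x \<in> \<O> \<Longrightarrow> i + j < m + n + 1 \<Longrightarrow>
      f x (i, j) = act x v (i, j) - v (i, j) + \<alpha> * z1 x (i, j) + \<beta> * z2 x (i, j)"
    using cocycle_eq_below_degree[OF f, of "m + n + 1"] by blast
  show ?thesis
  proof (rule that[OF v], rule ext, clarify)
    fix x i j assume x: "x \<in> \<O>"
    show "f x (i, j) = (act x v - v + (\<lambda>i. \<alpha> * z1 x i) + (\<lambda>i. \<beta> * z2 x i)) (i, j)"
    proof (cases "i \<le> m \<and> j \<le> n")
      case True
      then show ?thesis using eq[OF x, of i j] by simp
    next
      case False
      then show ?thesis
        using f x act_closed[of x v] v by (auto simp: cocycle_def tensor_space_iff z1_def z2_def)
    qed
  qed
qed

text \<open>At the corner (0, n) a coboundary is a polynomial in \<sigma>(x) alone, while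
  \<open>z1\<close> contributes x; at (m, 0) the roles are exchanged. Multiples of 1 and \<epsilon>
  provide the points for \<open>vanishing_linear_coeff\<close>.\<close>

lemma z1_z2_independent:
  assumes "n \<le> m" and eq: "\<And>x. x \<in> \<O> \<Longrightarrow> (\<lambda>i. \<alpha> * z1 x i) + (\<lambda>i. \<beta> * z2 x i) = act x v - v"
  shows "\<alpha> = 0 \<and> \<beta> = 0"
proof -
  have kx: "of_nat k * x \<in> \<O>" "\<sigma> (of_nat k * x) = of_nat k * \<sigma> x" if "x \<in> {1, \<epsilon>}" for k x
    using that O_one \<epsilon>_O by (auto intro: O_mult O_of_nat simp: \<sigma>_mult \<sigma>_of_nat \<sigma>_one F_of_nat O_F)
  have ne: "complex_of_real 1 * of_real (\<sigma> \<epsilon>) \<noteq> of_real \<epsilon> * of_real (\<sigma> 1)"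
    "of_real (\<sigma> 1) * complex_of_real \<epsilon> \<noteq> of_real (\<sigma> \<epsilon>) * of_real 1"
    using \<sigma>_\<epsilon>_neq by (auto simp: \<sigma>_one)
  have eqi: "\<alpha> * z1 x i + \<beta> * z2 x i = act x v i - v i" if "x \<in> \<O>" for x i
    using fun_cong[OF eq[OF that], of i] by simp
  show ?thesis
  \<comment> \<open>With \<open>n \<le> m\<close> this makes V one-dimensional with trivial action.
    Both corners then coincide, so coboundaries vanish and the values at 1 and \<epsilon>
    decide.\<close>
  proof (cases "m = 0")
    case True
    then have "\<alpha> * of_real x + \<beta> * of_real (\<sigma> x) = 0" if "x \<in> \<O>" for x
      using eqi[OF that, of "(0, 0)", unfolded z1_def z2_def act_def] \<open>n \<le> m\<close> by (simp add: unip_index)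
    from this[OF O_one] this[OF \<epsilon>_O] have 1: "\<beta> = - \<alpha>" "\<alpha> * of_real \<epsilon> + \<beta> * of_real (\<sigma> \<epsilon>) = 0"
      by (simp_all add: \<sigma>_one eq_neg_iff_add_eq_0 add.commute)
    then have "\<alpha> * (of_real \<epsilon> - of_real (\<sigma> \<epsilon>)) = 0" by (simp add: algebra_simps)
    then show ?thesis using \<sigma>_\<epsilon>_neq 1 by auto
  next
    case m: False
    \<comment> \<open>The top summand is the entry of \<open>v\<close> itself, which cancels in
      \<open>act x v - v\<close>.\<close>
    have split: "sum f {..k} = f k + sum f {..<k}" for f :: "nat \<Rightarrow> complex" and k
      by (simp add: lessThan_Suc_atMost[symmetric] add.commute)
    have \<alpha>: "\<alpha> = 0"
    proof (rule vanishing_linear_coeff[where s = of_real and t = "\<lambda>x. of_real (\<sigma> x)"])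
      show "complex_of_real 1 * of_real (\<sigma> \<epsilon>) \<noteq> of_real \<epsilon> * of_real (\<sigma> 1)" by (rule ne)
      fix x k assume x: "x \<in> {1, \<epsilon>}"
      show "\<alpha> * (of_nat k * of_real x)
          = (\<Sum>l<n. (of_nat (n choose l) * v (0, l)) * (of_nat k * of_real (\<sigma> x)) ^ (n - l))"
        using eqi[OF kx(1)[OF x, of k], of "(0, n)",
            unfolded act_def z1_def z2_def kx(2)[OF x]] m
        by (simp add: unip_index split mult_ac)
    qed
    \<comment> \<open>For \<open>n = 0\<close> the cocycle \<open>z1\<close> also has an entry at
      (m, 0); it drops out because \<alpha> = 0 is already known.\<close>
    have "\<beta> = 0"
    proof (rule vanishing_linear_coeff[where s = "\<lambda>x. of_real (\<sigma> x)" and t = of_real])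
      show "of_real (\<sigma> 1) * complex_of_real \<epsilon> \<noteq> of_real (\<sigma> \<epsilon>) * of_real 1" by (rule ne)
      fix x k assume x: "x \<in> {1, \<epsilon>}"
      show "\<beta> * (of_nat k * of_real (\<sigma> x))
          = (\<Sum>l<m. (of_nat (m choose l) * v (l, 0)) * (of_nat k * of_real x) ^ (m - l))"
        using eqi[OF kx(1)[OF x, of k], of "(m, 0)",
            unfolded act_def z1_def z2_def kx(2)[OF x]]
        by (simp add: unip_index split mult_ac \<alpha>)
    qed
    with \<alpha> show ?thesis by simp
  qed
qed

end

section \<open>First cohomology of a subgroup\<close>

locale h1_module = group G for G (structure) +
  fixes N :: "'a set" and V :: "('i \<Rightarrow> complex) set" and a :: "'a \<Rightarrow> ('i \<Rightarrow> complex) \<Rightarrow> 'i \<Rightarrow> complex"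
  assumes N: "subgroup N G"
    and V_zero: "0 \<in> V"
    and V_add: "v \<in> V \<Longrightarrow> w \<in> V \<Longrightarrow> v + w \<in> V"
    and V_scale: "v \<in> V \<Longrightarrow> (\<lambda>i. z * v i) \<in> V"
    and a_closed: "x \<in> carrier G \<Longrightarrow> v \<in> V \<Longrightarrow> a x v \<in> V"
    and a_add: "x \<in> carrier G \<Longrightarrow> v \<in> V \<Longrightarrow> w \<in> V \<Longrightarrow> a x (v + w) = a x v + a x w"
    and a_scale: "x \<in> carrier G \<Longrightarrow> v \<in> V \<Longrightarrow> a x (\<lambda>i. z * v i) = (\<lambda>i. z * a x v i)"
    and a_mult: "x \<in> carrier G \<Longrightarrow> y \<in> carrier G \<Longrightarrow> v \<in> V \<Longrightarrow> a (x \<otimes> y) v = a x (a y v)"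
begin

abbreviation "Z \<equiv> cocycles1 G N V a"
abbreviation "rel \<equiv> cohom_rel1 G N V a"

text \<open>The map behind \<open>H1_act\<close> on single cochains, as \<open>scale_op\<close> is
  for \<open>H1_scale\<close>; compatibility with \<open>rel\<close> later lets both be computed on
  representatives.\<close>

definition conj_op :: "'a \<Rightarrow> ('a \<Rightarrow> 'i \<Rightarrow> complex) \<Rightarrow> 'a \<Rightarrow> 'i \<Rightarrow> complex" where
  "conj_op p f = (\<lambda>n\<in>N. a (inv p) (f (p \<otimes> n \<otimes> inv p)))"

definition scale_op :: "complex \<Rightarrow> ('a \<Rightarrow> 'i \<Rightarrow> complex) \<Rightarrow> 'a \<Rightarrow> 'i \<Rightarrow> complex" where
  "scale_op z f = (\<lambda>x\<in>N. \<lambda>i. z * f x i)"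

lemma N_carrier: "x \<in> N \<Longrightarrow> x \<in> carrier G"
  and N_mult: "x \<in> N \<Longrightarrow> y \<in> N \<Longrightarrow> x \<otimes> y \<in> N"
  using N by (auto simp: subgroup.mem_carrier subgroup.m_closed)

lemma V_uminus: "v \<in> V \<Longrightarrow> - v \<in> V"
  using V_scale[of v "- 1"] by (simp add: fun_Compl_def)

lemma a_uminus: "x \<in> carrier G \<Longrightarrow> v \<in> V \<Longrightarrow> a x (- v) = - a x v"
  using a_scale[of x v "- 1"] by (simp add: fun_Compl_def)

lemma a_diff: "x \<in> carrier G \<Longrightarrow> v \<in> V \<Longrightarrow> w \<in> V \<Longrightarrow> a x (v - w) = a x v - a x w"
  using a_add[of x v "- w"] V_uminus[of w] a_uminus[of x w] by simp

lemma a_zero: "x \<in> carrier G \<Longrightarrow> a x 0 = 0"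
  using a_diff[of x 0 0] V_zero by simp

lemma Z_iff: "f \<in> Z \<longleftrightarrow> (\<forall>x\<in>N. f x \<in> V) \<and> f \<in> extensional N
    \<and> (\<forall>x\<in>N. \<forall>y\<in>N. f (x \<otimes> y) = f x + a x (f y))"
  by (auto simp: cocycles1_def PiE_def)

lemma Z_closed: "f \<in> Z \<Longrightarrow> x \<in> N \<Longrightarrow> f x \<in> V"
  by (simp add: Z_iff)

lemma rel_iff: "(f, h) \<in> rel \<longleftrightarrow> f \<in> Z \<and> h \<in> Z \<and> (\<exists>v\<in>V. \<forall>x\<in>N. f x - h x = a x v - v)"
proof -
  have "(\<lambda>x\<in>N. f x - h x) = (\<lambda>x\<in>N. a x v - v) \<longleftrightarrow> (\<forall>x\<in>N. f x - h x = a x v - v)" for v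
  proof (intro iffI ballI)
    fix x assume eq: "(\<lambda>x\<in>N. f x - h x) = (\<lambda>x\<in>N. a x v - v)" and x: "x \<in> N"
    from fun_cong[OF eq, of x] show "f x - h x = a x v - v" unfolding restrict_apply'[OF x] .
  qed (auto intro: restrict_ext)
  then show ?thesis unfolding cohom_rel1_def coboundaries1_def by auto
qed

lemma rel_equiv: "equiv Z rel"
proof (rule equivI)
  show "rel \<subseteq> Z \<times> Z" by (auto simp: rel_iff)
  show "refl_on Z rel"
    by (rule refl_onI) (auto simp: rel_iff a_zero N_carrier intro!: bexI[OF _ V_zero])
  show "sym rel"
  proof (rule symI)
    fix f h assume "(f, h) \<in> rel"
    then obtain v where v: "f \<in> Z" "h \<in> Z" "v \<in> V" "\<And>x. x \<in> N \<Longrightarrow> f x - h x = a x v - v"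
      by (auto simp: rel_iff)
    have "h x - f x = a x (- v) - - v" if "x \<in> N" for x
      using v(4)[OF that] a_uminus[OF N_carrier[OF that] v(3)] by (simp add: algebra_simps)
    then show "(h, f) \<in> rel"
      unfolding rel_iff using v(1,2) V_uminus[OF v(3)] by blast
  qed
  show "trans rel"
  proof (rule transI)
    fix f h k assume "(f, h) \<in> rel" "(h, k) \<in> rel"
    then obtain v w where v: "f \<in> Z" "h \<in> Z" "k \<in> Z" "v \<in> V" "w \<in> V"
      "\<And>x. x \<in> N \<Longrightarrow> f x - h x = a x v - v" "\<And>x. x \<in> N \<Longrightarrow> h x - k x = a x w - w"
      by (auto simp: rel_iff)
    have "f x - k x = a x (v + w) - (v + w)" if "x \<in> N" for x
    proof -
      have "f x - k x = (f x - h x) + (h x - k x)" by simp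
      also have "\<dots> = a x (v + w) - (v + w)"
        using v that by (simp add: a_add N_carrier)
      finally show ?thesis .
    qed
    then show "(f, k) \<in> rel"
      unfolding rel_iff using v(1,3) V_add[OF v(4,5)] by blast
  qed
qed

lemma zero_Z: "(\<lambda>x\<in>N. 0) \<in> Z"
  by (auto simp: Z_iff V_zero a_zero N_carrier N_mult)

lemma scale_op_Z: "f \<in> Z \<Longrightarrow> scale_op z f \<in> Z"
proof -
  assume f: "f \<in> Z"
  have "scale_op z f (x \<otimes> y) = scale_op z f x + a x (scale_op z f y)" if "x \<in> N" "y \<in> N" for x y
  proof -
    have "f (x \<otimes> y) = f x + a x (f y)" using f that by (simp add: Z_iff)
    then show ?thesis
      using that Z_closed[OF f] by (simp add: scale_op_def N_mult a_scale N_carrier fun_eq_iff algebra_simps)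
  qed
  then show ?thesis using f by (auto simp: Z_iff scale_op_def V_scale)
qed

lemma scale_op_rel: "(f, h) \<in> rel \<Longrightarrow> (scale_op z f, scale_op z h) \<in> rel"
proof -
  assume "(f, h) \<in> rel"
  then obtain v where v: "f \<in> Z" "h \<in> Z" "v \<in> V" "\<And>x. x \<in> N \<Longrightarrow> f x - h x = a x v - v"
    by (auto simp: rel_iff)
  have "scale_op z f x - scale_op z h x = a x (\<lambda>i. z * v i) - (\<lambda>i. z * v i)" if "x \<in> N" for x
  proof -
    have "f x i - h x i = a x v i - v i" for i using fun_cong[OF v(4)[OF that], of i] by simp
    then show ?thesis
      using that by (simp add: scale_op_def a_scale N_carrier v(3) fun_eq_iff flip: right_diff_distrib)
  qed
  then show ?thesis
    unfolding rel_iff using v(1,2) V_scale[OF v(3)] scale_op_Z by blast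
qed

definition normalizing :: "'a \<Rightarrow> bool" where
  "normalizing p \<longleftrightarrow> p \<in> carrier G \<and> (\<forall>n\<in>N. p \<otimes> n \<otimes> inv p \<in> N)"

text \<open>Conjugation is a homomorphism; the second equation lets p^(-1) pass a conjugate, so that
  acting by p x p^(-1) and then by p^(-1) is acting by p^(-1) and then by x.\<close>

lemma conj_mult:
  assumes "p \<in> carrier G" "x \<in> carrier G" "y \<in> carrier G"
  shows "p \<otimes> (x \<otimes> y) \<otimes> inv p = (p \<otimes> x \<otimes> inv p) \<otimes> (p \<otimes> y \<otimes> inv p)"
    and "inv p \<otimes> (p \<otimes> x \<otimes> inv p) = x \<otimes> inv p"
proof -
  have 2: "inv p \<otimes> (p \<otimes> x \<otimes> inv p) = x \<otimes> inv p" if "x \<in> carrier G" for x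
    using assms(1) that by (simp add: m_assoc[symmetric])
  have "(p \<otimes> x \<otimes> inv p) \<otimes> (p \<otimes> y \<otimes> inv p) = p \<otimes> x \<otimes> (inv p \<otimes> (p \<otimes> y \<otimes> inv p))"
    using assms by (simp add: m_assoc)
  also have "\<dots> = p \<otimes> (x \<otimes> y) \<otimes> inv p"
    unfolding 2[OF assms(3)] using assms by (simp add: m_assoc)
  finally show "p \<otimes> (x \<otimes> y) \<otimes> inv p = (p \<otimes> x \<otimes> inv p) \<otimes> (p \<otimes> y \<otimes> inv p)" by simp
  show "inv p \<otimes> (p \<otimes> x \<otimes> inv p) = x \<otimes> inv p" by (rule 2[OF assms(2)])
qed

lemma conj_op_Z:
  assumes p: "normalizing p" and f: "f \<in> Z"
  shows "conj_op p f \<in> Z"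
proof -
  have pc: "p \<in> carrier G" "inv p \<in> carrier G" using p by (auto simp: normalizing_def)
  have pn: "p \<otimes> x \<otimes> inv p \<in> N" if "x \<in> N" for x using p that by (auto simp: normalizing_def)
  have "conj_op p f (x \<otimes> y) = conj_op p f x + a x (conj_op p f y)" if xy: "x \<in> N" "y \<in> N" for x y
  proof -
    let ?x = "p \<otimes> x \<otimes> inv p" and ?y = "p \<otimes> y \<otimes> inv p"
    have "f (p \<otimes> (x \<otimes> y) \<otimes> inv p) = f ?x + a ?x (f ?y)"
      using conj_mult(1)[OF pc(1), of x y] f pn xy by (simp add: Z_iff N_carrier)
    then have 1: "conj_op p f (x \<otimes> y) = a (inv p) (f ?x) + a (inv p) (a ?x (f ?y))"
      using xy pc pn Z_closed[OF f] by (simp add: conj_op_def N_mult a_add a_closed N_carrier)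
    have 2: "a (inv p) (a ?x (f ?y)) = a x (a (inv p) (f ?y))"
      using xy pc pn Z_closed[OF f] conj_mult(2)[OF pc(1) N_carrier[OF xy(1)] pc(1)]
      by (simp add: a_mult[symmetric] N_carrier)
    show ?thesis unfolding 1 2 using xy by (simp add: conj_op_def)
  qed
  then show ?thesis
    using f pc pn by (auto simp: Z_iff a_closed) (auto simp: conj_op_def a_closed)
qed

text \<open>The coboundary of \<open>v\<close> is sent to the coboundary of p^(-1) v.\<close>

lemma conj_op_rel:
  assumes p: "normalizing p" and "(f, h) \<in> rel"
  shows "(conj_op p f, conj_op p h) \<in> rel"
proof -
  obtain v where v: "f \<in> Z" "h \<in> Z" "v \<in> V" "\<And>x. x \<in> N \<Longrightarrow> f x - h x = a x v - v"
    using assms(2) by (auto simp: rel_iff)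
  have pc: "p \<in> carrier G" "inv p \<in> carrier G" using p by (auto simp: normalizing_def)
  have pn: "p \<otimes> x \<otimes> inv p \<in> N" if "x \<in> N" for x using p that by (auto simp: normalizing_def)
  have "conj_op p f x - conj_op p h x = a x (a (inv p) v) - a (inv p) v" if x: "x \<in> N" for x
  proof -
    let ?x = "p \<otimes> x \<otimes> inv p"
    have "conj_op p f x - conj_op p h x = a (inv p) (f ?x - h ?x)"
      using x pc pn v(1-3) by (simp add: conj_op_def a_diff Z_closed)
    also have "\<dots> = a (inv p) (a ?x v) - a (inv p) v"
      using x pc pn v by (simp add: a_diff a_closed N_carrier)
    also have "a (inv p) (a ?x v) = a x (a (inv p) v)"
      using x pc pn v conj_mult(2)[OF pc(1) N_carrier[OF x] pc(1)]
      by (simp add: a_mult[symmetric] N_carrier)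
    finally show ?thesis .
  qed
  then show ?thesis
    unfolding rel_iff using conj_op_Z[OF p] v(1,2) a_closed[OF pc(2) v(3)] by blast
qed

text \<open>Independence of the representative collapses the union in the definition to a single
  class.\<close>

lemma H1_act_class:
  assumes p: "normalizing p" and f: "f \<in> Z"
  shows "H1_act G N V a p (rel `` {f}) = rel `` {conj_op p f}"
proof -
  have "(\<lambda>f. rel `` {conj_op p f}) respects rel"
    by (rule congruentI) (metis conj_op_rel[OF p] equiv_class_eq[OF rel_equiv])
  from UN_equiv_class[OF rel_equiv this f] show ?thesis
    unfolding H1_act_def conj_op_def .
qed

lemma H1_scale_class:
  assumes f: "f \<in> Z"
  shows "H1_scale G N V a z (rel `` {f}) = rel `` {scale_op z f}"
proof -
  have "(\<lambda>f. rel `` {scale_op z f}) respects rel"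
    by (rule congruentI) (metis scale_op_rel equiv_class_eq[OF rel_equiv])
  from UN_equiv_class[OF rel_equiv this f] show ?thesis
    unfolding H1_scale_def scale_op_def .
qed

lemma H1_cases:
  assumes "X \<in> H1 G N V a"
  obtains f where "f \<in> Z" "X = rel `` {f}"
  using assms unfolding H1_def by (auto elim: quotientE)

lemma class_eq_iff: "f \<in> Z \<Longrightarrow> h \<in> Z \<Longrightarrow> rel `` {f} = rel `` {h} \<longleftrightarrow> (f, h) \<in> rel"
  by (rule eq_equiv_class_iff[OF rel_equiv])

lemma H1_zero_act:
  assumes "normalizing p"
  shows "H1_act G N V a p (H1_zero G N V a) = H1_zero G N V a"
proof -
  have "conj_op p (\<lambda>x\<in>N. 0) = (\<lambda>x\<in>N. 0)"
    using assms by (auto simp: conj_op_def normalizing_def a_zero fun_eq_iff restrict_def)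
  then show ?thesis
    unfolding H1_zero_def H1_act_class[OF assms zero_Z] by simp
qed

end

text \<open>Two cocycles whose classes form a basis of H^1, being eigenvectors already as cochains.
  What follows is linear algebra in the coordinates (\<alpha>, \<beta>) of
  \<open>comb\<close>.\<close>

locale h1_basis = h1_module +
  fixes p f\<^sub>1 f\<^sub>2 \<mu>\<^sub>1 \<mu>\<^sub>2
  assumes p: "normalizing p"
    and Z1: "f\<^sub>1 \<in> Z" and Z2: "f\<^sub>2 \<in> Z"
    and eigen1: "\<And>n. n \<in> N \<Longrightarrow> a (inv p) (f\<^sub>1 (p \<otimes> n \<otimes> inv p)) = (\<lambda>i. \<mu>\<^sub>1 * f\<^sub>1 n i)"
    and eigen2: "\<And>n. n \<in> N \<Longrightarrow> a (inv p) (f\<^sub>2 (p \<otimes> n \<otimes> inv p)) = (\<lambda>i. \<mu>\<^sub>2 * f\<^sub>2 n i)"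
    and span: "\<And>f. f \<in> Z \<Longrightarrow> \<exists>v\<in>V. \<exists>\<alpha> \<beta>. \<forall>x\<in>N.
      f x = (a x v - v) + (\<lambda>i. \<alpha> * f\<^sub>1 x i) + (\<lambda>i. \<beta> * f\<^sub>2 x i)"
    and indep: "\<And>v \<alpha> \<beta>. v \<in> V \<Longrightarrow> (\<forall>x\<in>N. (\<lambda>i. \<alpha> * f\<^sub>1 x i) + (\<lambda>i. \<beta> * f\<^sub>2 x i) = a x v - v)
      \<Longrightarrow> \<alpha> = 0 \<and> \<beta> = 0"
begin

definition comb where
  "comb \<alpha> \<beta> = (\<lambda>x\<in>N. (\<lambda>i. \<alpha> * f\<^sub>1 x i) + (\<lambda>i. \<beta> * f\<^sub>2 x i))"

lemma comb_Z: "comb \<alpha> \<beta> \<in> Z"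
proof -
  have "comb \<alpha> \<beta> (x \<otimes> y) = comb \<alpha> \<beta> x + a x (comb \<alpha> \<beta> y)" if "x \<in> N" "y \<in> N" for x y
  proof -
    have "f\<^sub>1 (x \<otimes> y) = f\<^sub>1 x + a x (f\<^sub>1 y)" "f\<^sub>2 (x \<otimes> y) = f\<^sub>2 x + a x (f\<^sub>2 y)"
      using Z1 Z2 that by (auto simp: Z_iff)
    then show ?thesis
      using that Z_closed[OF Z1] Z_closed[OF Z2]
      by (simp add: comb_def N_mult a_add a_scale V_scale N_carrier fun_eq_iff algebra_simps)
  qed
  then show ?thesis
    using Z_closed[OF Z1] Z_closed[OF Z2] by (auto simp: Z_iff V_add V_scale comb_def)
qed

lemma comb_conj: "conj_op p (comb \<alpha> \<beta>) = comb (\<alpha> * \<mu>\<^sub>1) (\<beta> * \<mu>\<^sub>2)"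
proof
  fix n
  show "conj_op p (comb \<alpha> \<beta>) n = comb (\<alpha> * \<mu>\<^sub>1) (\<beta> * \<mu>\<^sub>2) n"
  proof (cases "n \<in> N")
    case True
    then have "p \<otimes> n \<otimes> inv p \<in> N" "inv p \<in> carrier G" using p by (auto simp: normalizing_def)
    then show ?thesis
      using True Z_closed[OF Z1] Z_closed[OF Z2]
      by (simp add: conj_op_def comb_def a_add a_scale V_scale eigen1 eigen2 mult.assoc)
  qed (simp add: conj_op_def comb_def)
qed

lemma comb_scale: "scale_op z (comb \<alpha> \<beta>) = comb (z * \<alpha>) (z * \<beta>)"
  by (auto simp: scale_op_def comb_def restrict_def fun_eq_iff algebra_simps)

lemma comb_rel_iff: "(comb \<alpha> \<beta>, comb \<gamma> \<delta>) \<in> rel \<longleftrightarrow> \<alpha> = \<gamma> \<and> \<beta> = \<delta>"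
proof
  assume "(comb \<alpha> \<beta>, comb \<gamma> \<delta>) \<in> rel"
  then obtain v where v: "v \<in> V" "\<And>x. x \<in> N \<Longrightarrow> comb \<alpha> \<beta> x - comb \<gamma> \<delta> x = a x v - v"
    by (auto simp: rel_iff)
  have "(\<lambda>i. (\<alpha> - \<gamma>) * f\<^sub>1 x i) + (\<lambda>i. (\<beta> - \<delta>) * f\<^sub>2 x i) = a x v - v" if "x \<in> N" for x
    unfolding v(2)[OF that, symmetric] using that by (simp add: comb_def fun_eq_iff algebra_simps)
  then show "\<alpha> = \<gamma> \<and> \<beta> = \<delta>"
    using indep[OF v(1), of "\<alpha> - \<gamma>" "\<beta> - \<delta>"] by simp
next
  assume "\<alpha> = \<gamma> \<and> \<beta> = \<delta>"
  then show "(comb \<alpha> \<beta>, comb \<gamma> \<delta>) \<in> rel"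
    using rel_equiv comb_Z by (auto simp: equiv_def refl_on_def)
qed

lemma comb_zero: "comb 0 0 = (\<lambda>x\<in>N. 0)"
  by (auto simp: comb_def restrict_def fun_eq_iff)

lemma H1_comb:
  assumes "X \<in> H1 G N V a"
  obtains \<alpha> \<beta> where "X = rel `` {comb \<alpha> \<beta>}"
proof -
  obtain f where f: "f \<in> Z" "X = rel `` {f}" using assms by (rule H1_cases)
  obtain v \<alpha> \<beta> where v: "v \<in> V"
    "\<And>x. x \<in> N \<Longrightarrow> f x = (a x v - v) + (\<lambda>i. \<alpha> * f\<^sub>1 x i) + (\<lambda>i. \<beta> * f\<^sub>2 x i)"
    using span[OF f(1)] by blast
  have "f x - comb \<alpha> \<beta> x = a x v - v" if "x \<in> N" for x
    using that by (simp add: comb_def v(2))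
  then have "(f, comb \<alpha> \<beta>) \<in> rel"
    using f v(1) comb_Z by (auto simp: rel_iff)
  then show ?thesis using that class_eq_iff[OF f(1) comb_Z] f(2) by blast
qed

lemma comb_class_zero_iff: "rel `` {comb \<alpha> \<beta>} = H1_zero G N V a \<longleftrightarrow> \<alpha> = 0 \<and> \<beta> = 0"
  unfolding H1_zero_def comb_zero[symmetric] class_eq_iff[OF comb_Z comb_Z] comb_rel_iff ..

lemma comb_eigen_iff: "H1_act G N V a p (rel `` {comb \<alpha> \<beta>}) = H1_scale G N V a z (rel `` {comb \<alpha> \<beta>})
    \<longleftrightarrow> \<alpha> * \<mu>\<^sub>1 = z * \<alpha> \<and> \<beta> * \<mu>\<^sub>2 = z * \<beta>"
  unfolding H1_act_class[OF p comb_Z] H1_scale_class[OF comb_Z] comb_conj comb_scale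
    class_eq_iff[OF comb_Z comb_Z] comb_rel_iff ..

text \<open>In coordinates the eigenvector equation decouples into
  \<open>\<alpha> * \<mu>\<^sub>1 = z * \<alpha>\<close> and
  \<open>\<beta> * \<mu>\<^sub>2 = z * \<beta>\<close>. The pairs (1, 0) and (0, 1) realize both
  values.\<close>

lemma eigenvalues: "H1_eigenvalues G N V a p = {\<mu>\<^sub>1, \<mu>\<^sub>2}"
proof
  show "H1_eigenvalues G N V a p \<subseteq> {\<mu>\<^sub>1, \<mu>\<^sub>2}"
  proof
    fix z assume "z \<in> H1_eigenvalues G N V a p"
    then obtain X where X: "X \<in> H1 G N V a" "X \<noteq> H1_zero G N V a"
      "H1_act G N V a p X = H1_scale G N V a z X"
      by (auto simp: H1_eigenvalues_def)
    obtain \<alpha> \<beta> where "X = rel `` {comb \<alpha> \<beta>}" using H1_comb[OF X(1)] .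
    with X show "z \<in> {\<mu>\<^sub>1, \<mu>\<^sub>2}"
      by (auto simp: comb_class_zero_iff comb_eigen_iff)
  qed
next
  have "z \<in> H1_eigenvalues G N V a p"
    if ab: "\<not> (\<alpha> = 0 \<and> \<beta> = 0)" "\<alpha> * \<mu>\<^sub>1 = z * \<alpha> \<and> \<beta> * \<mu>\<^sub>2 = z * \<beta>" for z \<alpha> \<beta>
    unfolding H1_eigenvalues_def
  proof (intro CollectI bexI conjI)
    show "rel `` {comb \<alpha> \<beta>} \<noteq> H1_zero G N V a"
      unfolding comb_class_zero_iff by (rule ab(1))
    show "H1_act G N V a p (rel `` {comb \<alpha> \<beta>}) = H1_scale G N V a z (rel `` {comb \<alpha> \<beta>})"
      unfolding comb_eigen_iff by (rule ab(2))
    show "rel `` {comb \<alpha> \<beta>} \<in> H1 G N V a"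
      unfolding H1_def using comb_Z by (rule quotientI)
  qed
  from this[of 1 0 \<mu>\<^sub>1] this[of 0 1 \<mu>\<^sub>2]
  show "{\<mu>\<^sub>1, \<mu>\<^sub>2} \<subseteq> H1_eigenvalues G N V a p" by simp
qed

text \<open>Invariance under \<open>p\<close> alone says that a class is an eigenvector for 1, which
  leaves only zero. Conversely every element of every coset lies in \<open>P\<close> and normalizes
  \<open>N\<close>, hence fixes the zero class.\<close>

lemma invariants:
  assumes P: "N \<subseteq> P" "p \<in> P" "\<And>q. q \<in> P \<Longrightarrow> normalizing q"
    "\<And>q r. q \<in> P \<Longrightarrow> r \<in> P \<Longrightarrow> q \<otimes> r \<in> P"
    and ne: "\<mu>\<^sub>1 \<noteq> 1" "\<mu>\<^sub>2 \<noteq> 1"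
  shows "H1_invariants G P N V a = {H1_zero G N V a}"
proof
  show "H1_invariants G P N V a \<subseteq> {H1_zero G N V a}"
  proof
    fix X assume "X \<in> H1_invariants G P N V a"
    then have X: "X \<in> H1 G N V a"
      and inv: "\<And>C q. C \<in> carrier (G\<lparr>carrier := P\<rparr> Mod N) \<Longrightarrow> q \<in> C \<Longrightarrow> H1_act G N V a q X = X"
      by (auto simp: H1_invariants_def)
    have "\<one> \<in> N" using N by (rule subgroup.one_closed)
    then have "p \<in> N #>\<^bsub>G\<lparr>carrier := P\<rparr>\<^esub> p"
      using p unfolding r_coset_def normalizing_def by (auto intro!: bexI[of _ \<one>])
    moreover have "N #>\<^bsub>G\<lparr>carrier := P\<rparr>\<^esub> p \<in> carrier (G\<lparr>carrier := P\<rparr> Mod N)"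
      using P(2) by (simp add: carrier_FactGroup)
    ultimately have act: "H1_act G N V a p X = X" by (rule inv[rotated])
    obtain \<alpha> \<beta> where ab: "X = rel `` {comb \<alpha> \<beta>}" using H1_comb[OF X] .
    have "H1_scale G N V a 1 X = X"
      unfolding ab H1_scale_class[OF comb_Z] comb_scale by simp
    with act have "H1_act G N V a p (rel `` {comb \<alpha> \<beta>}) = H1_scale G N V a 1 (rel `` {comb \<alpha> \<beta>})"
      unfolding ab by (simp only:)
    then have "\<alpha> * \<mu>\<^sub>1 = 1 * \<alpha> \<and> \<beta> * \<mu>\<^sub>2 = 1 * \<beta>" by (simp only: comb_eigen_iff)
    with ne have "\<alpha> = 0 \<and> \<beta> = 0" by auto
    then show "X \<in> {H1_zero G N V a}" using ab comb_class_zero_iff by simp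
  qed
next
  have "H1_zero G N V a \<in> H1 G N V a"
    unfolding H1_def H1_zero_def using zero_Z by (rule quotientI)
  moreover have "normalizing q" if C: "C \<in> carrier (G\<lparr>carrier := P\<rparr> Mod N)" and q: "q \<in> C" for C q
  proof -
    obtain r where r: "r \<in> P" "C = N #>\<^bsub>G\<lparr>carrier := P\<rparr>\<^esub> r"
      using C by (auto simp: carrier_FactGroup)
    then obtain h where "h \<in> N" "q = h \<otimes> r"
      using q by (auto simp: r_coset_def)
    then show ?thesis using P r by blast
  qed
  ultimately show "{H1_zero G N V a} \<subseteq> H1_invariants G P N V a"
    using H1_zero_act by (auto simp: H1_invariants_def)
qed

end

section \<open>Cohomology of \<open>U\<close> as a module over \<open>P\<close>\<close>

lemma tensor_act_diagonal:
  assumes "i \<le> m" "j \<le> n"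
  shows "tensor_act (sym_rep m (mat22 a 0 0 d)) (sym_rep n (mat22 b 0 0 e)) v (i, j)
    = a ^ (m - i) * d ^ i * (b ^ (n - j) * e ^ j) * v (i, j)"
proof -
  have "tensor_act (sym_rep m (mat22 a 0 0 d)) (sym_rep n (mat22 b 0 0 e)) v (i, j)
      = (\<Sum>k\<le>m. \<Sum>l\<le>n. sym_rep m (mat22 a 0 0 d) $$ (i, k) * sym_rep n (mat22 b 0 0 e) $$ (j, l) * v (k, l))"
    using assms sym_rep_carrier[OF mat22_carrier, of m a 0 0 d] sym_rep_carrier[OF mat22_carrier, of n b 0 0 e]
    by (simp add: tensor_act_def lessThan_Suc_atMost)
  also have "\<dots> = (\<Sum>k\<le>m. \<Sum>l\<le>n. if l = j then
      if k = i then a ^ (m - i) * d ^ i * (b ^ (n - j) * e ^ j) * v (i, j) else 0 else 0)"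
    using assms by (intro sum.cong refl) (auto simp: sym_rep_diagonal_index)
  also have "\<dots> = a ^ (m - i) * d ^ i * (b ^ (n - j) * e ^ j) * v (i, j)"
    using assms by (simp add: sum.delta)
  finally show ?thesis .
qed

lemma psl_class_eq: "A \<in> carrier_mat 2 2 \<Longrightarrow> psl_class R A = {A, - A}"
  unfolding psl_class_def pm_one_def r_coset_def SL2_def
  by (auto simp: mat22_one elim!: mat22_cases)

lemma mat22_in_SL2:
  "mat22 a b c d \<in> carrier (SL2 R) \<longleftrightarrow> a \<in> R \<and> b \<in> R \<and> c \<in> R \<and> d \<in> R \<and> a * d - b * c = 1"
  by (auto simp: SL2_def)

lemma SL2_carrier_mat: "A \<in> carrier (SL2 R) \<Longrightarrow> A \<in> carrier_mat 2 2"
  by (simp add: SL2_def)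

lemma SL2_mult: "A \<otimes>\<^bsub>SL2 R\<^esub> B = A * B" and SL2_one: "\<one>\<^bsub>SL2 R\<^esub> = mat22 1 0 0 1"
  by (simp_all add: SL2_def mat22_one)

section \<open>PSL(2) over the integers of F and its lower triangular subgroups\<close>

context real_quadratic
begin

lemma SL2_group: "group (SL2 \<O>)"
proof (rule groupI)
  fix A B assume AB: "A \<in> carrier (SL2 \<O>)" "B \<in> carrier (SL2 \<O>)"
  obtain a b c d where A: "A = mat22 a b c d" using AB(1)[THEN SL2_carrier_mat] by (rule mat22_cases)
  obtain a' b' c' d' where B: "B = mat22 a' b' c' d'" using AB(2)[THEN SL2_carrier_mat] by (rule mat22_cases)
  have d: "a * d - b * c = 1" "a' * d' - b' * c' = 1"
    using AB by (auto simp: A B mat22_in_SL2)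
  have "(a * a' + b * c') * (c * b' + d * d') - (a * b' + b * d') * (c * a' + d * c')
      = (a * d - b * c) * (a' * d' - b' * c')"
    by (simp add: algebra_simps)
  then show "A \<otimes>\<^bsub>SL2 \<O>\<^esub> B \<in> carrier (SL2 \<O>)"
    using AB d by (simp add: A B SL2_mult mat22_in_SL2 O_add O_mult)
next
  show "\<one>\<^bsub>SL2 \<O>\<^esub> \<in> carrier (SL2 \<O>)"
    by (simp add: SL2_one mat22_in_SL2 O_zero O_one)
next
  fix A B C assume "A \<in> carrier (SL2 \<O>)" "B \<in> carrier (SL2 \<O>)" "C \<in> carrier (SL2 \<O>)"
  then show "A \<otimes>\<^bsub>SL2 \<O>\<^esub> B \<otimes>\<^bsub>SL2 \<O>\<^esub> C = A \<otimes>\<^bsub>SL2 \<O>\<^esub> (B \<otimes>\<^bsub>SL2 \<O>\<^esub> C)"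
    unfolding SL2_mult by (intro assoc_mult_mat[of _ 2 2 _ 2 _ 2] SL2_carrier_mat)
next
  fix A assume A: "A \<in> carrier (SL2 \<O>)"
  then show "\<one>\<^bsub>SL2 \<O>\<^esub> \<otimes>\<^bsub>SL2 \<O>\<^esub> A = A"
    using left_mult_one_mat[OF SL2_carrier_mat] by (simp add: SL2_mult SL2_one mat22_one)
  obtain a b c d where A': "A = mat22 a b c d" using A[THEN SL2_carrier_mat] by (rule mat22_cases)
  have "mat22 d (- b) (- c) a \<in> carrier (SL2 \<O>)"
    "mat22 d (- b) (- c) a \<otimes>\<^bsub>SL2 \<O>\<^esub> A = \<one>\<^bsub>SL2 \<O>\<^esub>"
    using A by (auto simp: A' mat22_in_SL2 SL2_mult SL2_one O_uminus algebra_simps)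
  then show "\<exists>B\<in>carrier (SL2 \<O>). B \<otimes>\<^bsub>SL2 \<O>\<^esub> A = \<one>\<^bsub>SL2 \<O>\<^esub>" by blast
qed

lemma pm_one_normal: "pm_one \<lhd> SL2 \<O>"
proof -
  interpret SL: group "SL2 \<O>" by (rule SL2_group)
  have pm: "pm_one = {mat22 1 0 0 1, mat22 (- 1) 0 0 (- 1)}"
    by (simp add: pm_one_def mat22_one)
  have carr: "mat22 1 0 0 1 \<in> carrier (SL2 \<O>)" "mat22 (- 1) 0 0 (- 1) \<in> carrier (SL2 \<O>)"
    by (auto simp: mat22_in_SL2 O_zero O_one O_uminus)
  have inv: "inv\<^bsub>SL2 \<O>\<^esub> mat22 1 0 0 1 = mat22 1 0 0 1"
    "inv\<^bsub>SL2 \<O>\<^esub> mat22 (- 1) 0 0 (- 1) = mat22 (- 1) 0 0 (- 1)"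
    by (rule SL.inv_equality, use carr in \<open>auto simp: SL2_mult SL2_one\<close>)+
  have "subgroup pm_one (SL2 \<O>)"
    by (rule SL.subgroupI) (use carr inv in \<open>auto simp: pm SL2_mult\<close>)
  moreover have "pm_one #>\<^bsub>SL2 \<O>\<^esub> A = A <#\<^bsub>SL2 \<O>\<^esub> pm_one" if "A \<in> carrier (SL2 \<O>)" for A
    using that[THEN SL2_carrier_mat]
    by (auto simp: r_coset_def l_coset_def SL2_mult pm elim!: mat22_cases)
  ultimately show ?thesis by (intro SL.normalI) auto
qed

lemma PSL2_group: "group (PSL2 \<O>)"
  unfolding PSL2_def by (rule normal.factorgroup_is_group[OF pm_one_normal])

lemma psl_class_carrier: "A \<in> carrier (SL2 \<O>) \<Longrightarrow> psl_class \<O> A \<in> carrier (PSL2 \<O>)"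
  by (auto simp: PSL2_def psl_class_def carrier_FactGroup)

lemma PSL2_cases:
  assumes "X \<in> carrier (PSL2 \<O>)"
  obtains A where "A \<in> carrier (SL2 \<O>)" "X = psl_class \<O> A"
  using assms by (auto simp: PSL2_def psl_class_def carrier_FactGroup)

lemma psl_class_mult:
  assumes "A \<in> carrier (SL2 \<O>)" "B \<in> carrier (SL2 \<O>)"
  shows "psl_class \<O> A \<otimes>\<^bsub>PSL2 \<O>\<^esub> psl_class \<O> B = psl_class \<O> (A * B)"
  using normal.rcos_sum[OF pm_one_normal assms] by (simp add: PSL2_def psl_class_def SL2_mult)

lemma psl_class_one: "\<one>\<^bsub>PSL2 \<O>\<^esub> = psl_class \<O> (mat22 1 0 0 1)"
  by (simp add: PSL2_def psl_class_eq) (simp add: pm_one_def mat22_one)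

lemma psl_class_inv:
  assumes "A \<in> carrier (SL2 \<O>)" "B \<in> carrier (SL2 \<O>)" "B * A = mat22 1 0 0 1"
  shows "inv\<^bsub>PSL2 \<O>\<^esub> psl_class \<O> A = psl_class \<O> B"
  using assms psl_class_carrier
  by (intro group.inv_equality[OF PSL2_group]) (auto simp: psl_class_mult psl_class_one)

lemma map_mat_\<sigma>_mult:
  assumes "A \<in> carrier (SL2 \<O>)" "B \<in> carrier (SL2 \<O>)"
  shows "map_mat \<sigma> (A * B) = map_mat \<sigma> A * map_mat \<sigma> B"
  using assms[THEN SL2_carrier_mat] assms
  by (elim mat22_cases) (simp add: mat22_in_SL2 \<sigma>_add \<sigma>_mult O_F F_mult)

lemma map_mat_of_real_mult:
  assumes "A \<in> carrier_mat 2 2" "B \<in> carrier_mat 2 2"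
  shows "map_mat complex_of_real (A * B) = map_mat complex_of_real A * map_mat complex_of_real B"
  using assms by (elim mat22_cases) simp

text \<open>Passing to -A produces the signs (-1)^m and (-1)^n, which cancel by parity; the image of
  the class is therefore a singleton.\<close>

lemma rep_V_class:
  assumes A: "A \<in> carrier (SL2 \<O>)" and par: "[m = n] (mod 2)"
  shows "rep_V \<sigma> m n (psl_class \<O> A) v = tensor_act (sym_rep m (map_mat complex_of_real A))
     (sym_rep n (map_mat complex_of_real (map_mat \<sigma> A))) v"
proof -
  let ?r = "\<lambda>g. tensor_act (sym_rep m (map_mat complex_of_real g))
     (sym_rep n (map_mat complex_of_real (map_mat \<sigma> g))) v"
  obtain a b c d where A': "A = mat22 a b c d" using A[THEN SL2_carrier_mat] by (rule mat22_cases)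
  have neg: "map_mat complex_of_real (- A) = - map_mat complex_of_real A"
    "map_mat complex_of_real (map_mat \<sigma> (- A)) = - map_mat complex_of_real (map_mat \<sigma> A)"
    using A by (auto simp: A' mat22_in_SL2 \<sigma>_uminus O_F)
  have "(- 1) ^ m * (- 1) ^ n = (1 :: complex)"
  proof -
    have "even m \<longleftrightarrow> even n" using par by (auto simp: cong_def even_iff_mod_2_eq_zero)
    then show ?thesis by (cases "even n") auto
  qed
  then have "?r (- A) = ?r A"
    unfolding neg using A[THEN SL2_carrier_mat]
    by (simp add: sym_rep_uminus tensor_act_smult)
  then have "?r ` psl_class \<O> A = {?r A}"
    using A[THEN SL2_carrier_mat] by (simp add: psl_class_eq)
  then show ?thesis by (simp add: rep_V_def)
qed

abbreviation low :: "real \<Rightarrow> real mat set" where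
  "low u \<equiv> psl_class \<O> (mat22 1 0 u 1)"

lemma low_SL2: "u \<in> \<O> \<Longrightarrow> mat22 1 0 u 1 \<in> carrier (SL2 \<O>)"
  by (simp add: mat22_in_SL2 O_zero O_one)

text \<open>Two representatives cannot be negatives of each other, as both have diagonal entries 1.
  Hence \<open>low\<close> gives a well-defined coordinate on U.\<close>

lemma low_inj: "low u = low w \<Longrightarrow> u = w"
  by (simp add: psl_class_eq doubleton_eq_iff)

text \<open>Representatives with diagonal -1 are negated, which turns \<open>u\<close> into
  \<open>- u\<close>.\<close>

lemma grp_U_eq: "grp_U F = low ` \<O>"
proof
  show "grp_U F \<subseteq> low ` \<O>"
  proof
    fix X assume "X \<in> grp_U F"
    then obtain s u where X: "X = psl_class \<O> (mat22 s 0 u s)" "s = 1 \<or> s = - 1" "u \<in> \<O>"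
      by (auto simp: grp_U_def)
    have "psl_class \<O> (mat22 (- 1) 0 u (- 1)) = low (- u)"
      by (auto simp: psl_class_eq)
    then show "X \<in> low ` \<O>" using X O_uminus by auto
  qed
  show "low ` \<O> \<subseteq> grp_U F" by (auto simp: grp_U_def)
qed

lemma low_mult: "u \<in> \<O> \<Longrightarrow> w \<in> \<O> \<Longrightarrow> low u \<otimes>\<^bsub>PSL2 \<O>\<^esub> low w = low (u + w)"
  by (simp add: psl_class_mult low_SL2)

lemma low_inv: "u \<in> \<O> \<Longrightarrow> inv\<^bsub>PSL2 \<O>\<^esub> low u = low (- u)"
  by (rule psl_class_inv) (simp_all add: low_SL2 O_uminus)

lemma grp_U_subgroup: "subgroup (grp_U F) (PSL2 \<O>)"
  unfolding grp_U_eq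
  by (rule group.subgroupI[OF PSL2_group])
     (use O_zero in \<open>auto simp: low_mult low_inv O_add O_uminus intro!: psl_class_carrier low_SL2\<close>)

abbreviation borel :: "real \<Rightarrow> real \<Rightarrow> real mat set" where
  "borel x u \<equiv> psl_class \<O> (mat22 x 0 u (inverse x))"

lemma unit_props:
  assumes "x \<in> integer_units F"
  shows "x \<in> \<O>" "inverse x \<in> \<O>" "x \<noteq> 0"
  using assms unit_inverse_O by (auto simp: integer_units_def)

lemma unit_inverse: "x \<in> integer_units F \<Longrightarrow> inverse x \<in> integer_units F"
  using unit_props[of x] by (auto simp: integer_units_def intro!: bexI[of _ x])

lemma unit_mult:
  assumes "x \<in> integer_units F" "y \<in> integer_units F"
  shows "x * y \<in> integer_units F"
proof -
  have "x * y * (inverse x * inverse y) = 1"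
    using unit_props(3)[OF assms(1)] unit_props(3)[OF assms(2)] by (simp add: field_simps)
  then show ?thesis
    unfolding integer_units_def using unit_props[OF assms(1)] unit_props[OF assms(2)] O_mult by blast
qed

lemma borel_SL2:
  assumes "x \<in> integer_units F" "u \<in> \<O>"
  shows "mat22 x 0 u (inverse x) \<in> carrier (SL2 \<O>)" "mat22 (inverse x) 0 (- u) x \<in> carrier (SL2 \<O>)"
  using unit_props[OF assms(1)] assms(2) by (auto simp: mat22_in_SL2 O_zero O_uminus)

lemma borel_inv:
  assumes "x \<in> integer_units F" "u \<in> \<O>"
  shows "inv\<^bsub>PSL2 \<O>\<^esub> borel x u = psl_class \<O> (mat22 (inverse x) 0 (- u) x)"
  by (rule psl_class_inv[OF borel_SL2[OF assms]]) (simp add: unit_props[OF assms(1)])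

text \<open>The entry \<open>u\<close> disappears because lower unipotent matrices commute; only the
  diagonal rescales. For t one has x = \<epsilon>^(-1), so the factor is \<epsilon>^2.\<close>

lemma borel_conj_low:
  assumes x: "x \<in> integer_units F" and u: "u \<in> \<O>" and w: "w \<in> \<O>"
  shows "borel x u \<otimes>\<^bsub>PSL2 \<O>\<^esub> low w \<otimes>\<^bsub>PSL2 \<O>\<^esub> inv\<^bsub>PSL2 \<O>\<^esub> borel x u = low ((inverse x)\<^sup>2 * w)"
proof -
  have "mat22 x 0 u (inverse x) * mat22 1 0 w 1 \<in> carrier (SL2 \<O>)"
    using unit_props[OF x] u w by (simp add: mat22_in_SL2 O_zero O_add O_mult)
  then have "borel x u \<otimes>\<^bsub>PSL2 \<O>\<^esub> low w \<otimes>\<^bsub>PSL2 \<O>\<^esub> inv\<^bsub>PSL2 \<O>\<^esub> borel x u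
      = psl_class \<O> (mat22 x 0 u (inverse x) * mat22 1 0 w 1 * mat22 (inverse x) 0 (- u) x)"
    unfolding borel_inv[OF x u] using borel_SL2[OF x u] low_SL2[OF w]
    by (simp only: psl_class_mult)
  also have "mat22 x 0 u (inverse x) * mat22 1 0 w 1 * mat22 (inverse x) 0 (- u) x
      = mat22 1 0 ((inverse x)\<^sup>2 * w) 1"
    using unit_props(3)[OF x] by (simp add: field_simps power2_eq_square)
  finally show ?thesis .
qed

lemma borel_mult:
  assumes "x \<in> integer_units F" "u \<in> \<O>" "y \<in> integer_units F" "w \<in> \<O>"
  shows "borel x u \<otimes>\<^bsub>PSL2 \<O>\<^esub> borel y w = borel (x * y) (u * y + inverse x * w)"
  using borel_SL2[OF assms(1,2)] borel_SL2[OF assms(3,4)] by (simp add: psl_class_mult)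

lemma grp_P_mult:
  assumes "q \<in> grp_P F" "r \<in> grp_P F"
  shows "q \<otimes>\<^bsub>PSL2 \<O>\<^esub> r \<in> grp_P F"
proof -
  obtain x u where q: "q = borel x u" "x \<in> integer_units F" "u \<in> \<O>"
    using assms(1) by (auto simp: grp_P_def)
  obtain y w where r: "r = borel y w" "y \<in> integer_units F" "w \<in> \<O>"
    using assms(2) by (auto simp: grp_P_def)
  have "u * y + inverse x * w \<in> \<O>"
    using unit_props[OF q(2)] unit_props[OF r(2)] q r by (intro O_add O_mult)
  then show ?thesis
    unfolding q(1) r(1) borel_mult[OF q(2,3) r(2,3)] grp_P_def using unit_mult[OF q(2) r(2)] by blast
qed

lemma grp_U_subset_grp_P: "grp_U F \<subseteq> grp_P F"
proof
  fix X assume "X \<in> grp_U F"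
  then obtain u where "X = borel 1 u" "u \<in> \<O>" by (auto simp: grp_U_eq)
  moreover have "1 \<in> integer_units F" using O_one by (auto simp: integer_units_def)
  ultimately show "X \<in> grp_P F" unfolding grp_P_def by blast
qed

lemma elem_t_eq: "elem_t F \<epsilon> = borel (inverse \<epsilon>) 0"
  by (simp add: elem_t_def)

end

text \<open>The weight m - 2i of t^(-1) and the 2(i + 1) from rescaling the argument add up to m +
  2, independently of \<open>i\<close>.\<close>

lemma real_power_shift:
  fixes e :: real
  assumes "e \<noteq> 0" "i \<le> m"
  shows "e ^ (m - i) * inverse e ^ i * (e\<^sup>2 * w) ^ (i + 1) = e ^ (m + 2) * w ^ (i + 1)"
proof -
  have "(e\<^sup>2 * w) ^ (i + 1) = e ^ i * e ^ i * (e\<^sup>2 * w ^ (i + 1))"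
    by (simp add: power_mult_distrib power2_eq_square mult_ac)
  then have "e ^ (m - i) * inverse e ^ i * (e\<^sup>2 * w) ^ (i + 1)
      = (e ^ (m - i) * e ^ i) * (inverse e ^ i * e ^ i) * (e\<^sup>2 * w ^ (i + 1))"
    by (simp only: mult_ac)
  also have "e ^ (m - i) * e ^ i = e ^ m" using assms(2) by (simp flip: power_add)
  also have "inverse e ^ i * e ^ i = 1" using assms(1) by (simp flip: power_mult_distrib)
  finally show ?thesis by (simp only: power_add mult_1_right mult.assoc)
qed

section \<open>The two cocycle classes as eigenvectors of t\<close>

locale h1_unipotent = unipotent_cocycles F \<sigma> \<epsilon> m n for F \<sigma> \<epsilon> m n +
  assumes n_le_m: "n \<le> m" and parity: "[m = n] (mod 2)"
begin

abbreviation "\<rho> \<equiv> rep_V \<sigma> m n"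

definition coord :: "real mat set \<Rightarrow> real" where
  "coord X = (THE u. X = low u)"

lemma coord_low [simp]: "coord (low u) = u"
  unfolding coord_def using low_inj by (intro the_equality) auto

definition f1 :: "real mat set \<Rightarrow> nat \<times> nat \<Rightarrow> complex" where
  "f1 = (\<lambda>X\<in>grp_U F. z1 (coord X))"

definition f2 :: "real mat set \<Rightarrow> nat \<times> nat \<Rightarrow> complex" where
  "f2 = (\<lambda>X\<in>grp_U F. z2 (coord X))"

definition \<mu>1 :: real where "\<mu>1 = \<epsilon> powi (int m + 2) * \<sigma> \<epsilon> powi (- int n)"

definition \<mu>2 :: real where "\<mu>2 = \<epsilon> powi (- int m - 2) * \<sigma> \<epsilon> powi (int n)"

lemma \<rho>_low: "u \<in> \<O> \<Longrightarrow> \<rho> (low u) v = act u v"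
  by (simp add: rep_V_class[OF low_SL2 parity] act_def unip_def \<sigma>_zero \<sigma>_one)

lemma \<rho>_closed: "X \<in> carrier (PSL2 \<O>) \<Longrightarrow> \<rho> X v \<in> tensor_space m n"
  by (elim PSL2_cases) (auto simp: rep_V_class[OF _ parity] SL2_carrier_mat
      intro!: tensor_act_closed[OF sym_rep_carrier sym_rep_carrier])

lemma \<rho>_mult:
  assumes "X \<in> carrier (PSL2 \<O>)" "Y \<in> carrier (PSL2 \<O>)"
  shows "\<rho> (X \<otimes>\<^bsub>PSL2 \<O>\<^esub> Y) v = \<rho> X (\<rho> Y v)"
proof -
  obtain A B where AB: "A \<in> carrier (SL2 \<O>)" "X = psl_class \<O> A" "B \<in> carrier (SL2 \<O>)" "Y = psl_class \<O> B"
    using assms by (elim PSL2_cases)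
  note c = AB(1,3)[THEN SL2_carrier_mat]
  have "A * B \<in> carrier (SL2 \<O>)"
    using monoid.m_closed[OF group.is_monoid[OF SL2_group] AB(1,3)] by (simp add: SL2_mult)
  then have "\<rho> (X \<otimes>\<^bsub>PSL2 \<O>\<^esub> Y) v = tensor_act (sym_rep m (map_mat complex_of_real (A * B)))
      (sym_rep n (map_mat complex_of_real (map_mat \<sigma> (A * B)))) v"
    by (simp add: AB psl_class_mult rep_V_class[OF _ parity])
  also have "map_mat \<sigma> (A * B) = map_mat \<sigma> A * map_mat \<sigma> B"
    by (rule map_mat_\<sigma>_mult[OF AB(1,3)])
  also have "tensor_act (sym_rep m (map_mat complex_of_real (A * B)))
      (sym_rep n (map_mat complex_of_real (map_mat \<sigma> A * map_mat \<sigma> B))) v = \<rho> X (\<rho> Y v)"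
    unfolding AB(2,4) rep_V_class[OF AB(1) parity] rep_V_class[OF AB(3) parity]
    using c by (simp add: map_mat_of_real_mult sym_rep_mult
        tensor_act_mult[OF sym_rep_carrier sym_rep_carrier sym_rep_carrier sym_rep_carrier])
  finally show ?thesis .
qed

lemma \<rho>_add: "X \<in> carrier (PSL2 \<O>) \<Longrightarrow> \<rho> X (v + w) = \<rho> X v + \<rho> X w"
  and \<rho>_scale: "X \<in> carrier (PSL2 \<O>) \<Longrightarrow> \<rho> X (\<lambda>i. z * v i) = (\<lambda>i. z * \<rho> X v i)"
  by (elim PSL2_cases, simp add: rep_V_class[OF _ parity] tensor_act_add tensor_act_scale)+

sublocale h1: h1_module "PSL2 \<O>" "grp_U F" "tensor_space m n" \<rho>
  by (intro h1_module.intro h1_module_axioms.intro PSL2_group grp_U_subgroup tensor_space_zero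
      tensor_space_add tensor_space_scale \<rho>_closed \<rho>_add \<rho>_scale \<rho>_mult)

lemma ball_grp_U: "(\<forall>X\<in>grp_U F. Q X) \<longleftrightarrow> (\<forall>u\<in>\<O>. Q (low u))"
  by (simp add: grp_U_eq)

lemma f1_low: "u \<in> \<O> \<Longrightarrow> f1 (low u) = z1 u" and f2_low: "u \<in> \<O> \<Longrightarrow> f2 (low u) = z2 u"
  by (simp_all add: f1_def f2_def grp_U_eq)

lemma f_cocycles: "f1 \<in> h1.Z" "f2 \<in> h1.Z"
proof -
  have "f1 \<in> extensional (grp_U F)" "f2 \<in> extensional (grp_U F)"
    by (simp_all add: f1_def f2_def)
  then show "f1 \<in> h1.Z" "f2 \<in> h1.Z"
    using cocycle_z1 cocycle_z2 unfolding h1.Z_iff ball_grp_U cocycle_def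
    by (simp_all add: f1_low f2_low low_mult O_add \<rho>_low)
qed

lemma normalizing_P:
  assumes "q \<in> grp_P F"
  shows "h1.normalizing q"
proof -
  obtain x u where q: "q = borel x u" "x \<in> integer_units F" "u \<in> \<O>"
    using assms by (auto simp: grp_P_def)
  have "(inverse x)\<^sup>2 * w \<in> \<O>" if "w \<in> \<O>" for w
    using unit_props[OF q(2)] that by (simp add: power2_eq_square O_mult)
  then show ?thesis
    unfolding h1.normalizing_def ball_grp_U q(1)
    using borel_SL2[OF q(2,3)] by (auto simp: borel_conj_low[OF q(2,3)] psl_class_carrier grp_U_eq)
qed

lemma t_P: "elem_t F \<epsilon> \<in> grp_P F"
  unfolding elem_t_eq grp_P_def using unit_inverse[OF \<epsilon>_unit] O_zero by blast

lemma t_conj: "u \<in> \<O> \<Longrightarrow>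
    elem_t F \<epsilon> \<otimes>\<^bsub>PSL2 \<O>\<^esub> low u \<otimes>\<^bsub>PSL2 \<O>\<^esub> inv\<^bsub>PSL2 \<O>\<^esub> elem_t F \<epsilon> = low (\<epsilon>\<^sup>2 * u)"
  using borel_conj_low[OF unit_inverse[OF \<epsilon>_unit] O_zero] by (simp add: elem_t_eq)

lemma \<epsilon>2_O: "u \<in> \<O> \<Longrightarrow> \<epsilon>\<^sup>2 * u \<in> \<O>"
  by (simp add: power2_eq_square O_mult \<epsilon>_O)

lemma \<sigma>_\<epsilon>2: "u \<in> \<O> \<Longrightarrow> \<sigma> (\<epsilon>\<^sup>2 * u) = (\<sigma> \<epsilon>)\<^sup>2 * \<sigma> u"
  by (simp add: power2_eq_square \<sigma>_mult F_mult O_F \<epsilon>_O)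

lemma \<rho>_t_inv:
  assumes "i \<le> m" "j \<le> n"
  shows "\<rho> (inv\<^bsub>PSL2 \<O>\<^esub> elem_t F \<epsilon>) v (i, j)
    = of_real (\<epsilon> ^ (m - i) * inverse \<epsilon> ^ i * (\<sigma> \<epsilon> ^ (n - j) * inverse (\<sigma> \<epsilon>) ^ j)) * v (i, j)"
proof -
  have "inv\<^bsub>PSL2 \<O>\<^esub> elem_t F \<epsilon> = psl_class \<O> (mat22 \<epsilon> 0 0 (inverse \<epsilon>))"
    using borel_inv[OF unit_inverse[OF \<epsilon>_unit] O_zero] by (simp add: elem_t_eq)
  then show ?thesis
    using borel_SL2(1)[OF \<epsilon>_unit O_zero] assms
    by (simp add: rep_V_class[OF _ parity] \<sigma>_zero \<sigma>_inverse O_F \<epsilon>_O tensor_act_diagonal)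
qed

lemma nonzero: "\<epsilon> \<noteq> 0" "\<sigma> \<epsilon> \<noteq> 0"
  using \<epsilon>_gt_1 \<sigma>_nonzero[OF O_F[OF \<epsilon>_O]] by auto

lemma \<mu>1_eq: "\<mu>1 = \<epsilon> ^ (m + 2) * inverse (\<sigma> \<epsilon>) ^ n"
proof -
  have "int m + 2 = int (m + 2)" by simp
  then show ?thesis
    by (simp only: \<mu>1_def power_int_of_nat power_int_minus power_inverse)
qed

lemma \<mu>2_eq: "\<mu>2 = inverse \<epsilon> ^ (m + 2) * \<sigma> \<epsilon> ^ n"
proof -
  have "- int m - 2 = - int (m + 2)" by simp
  then show ?thesis
    by (simp only: \<mu>2_def power_int_of_nat power_int_minus power_inverse)
qed

text \<open>The form in which the second eigenvalue arises from the action; since the norm of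
  \<epsilon> is 1 or -1, its square lets \<sigma>(\<epsilon>)^2 be traded for
  \<epsilon>^(-2).\<close>

lemma \<mu>2_eq': "\<mu>2 = inverse \<epsilon> ^ m * \<sigma> \<epsilon> ^ (n + 2)"
proof -
  have "(\<epsilon> * \<sigma> \<epsilon>)\<^sup>2 = 1" using abs_norm_\<epsilon> by (metis power2_abs one_power2)
  then have "(\<sigma> \<epsilon>)\<^sup>2 = (inverse \<epsilon>)\<^sup>2"
    using nonzero by (simp add: power_mult_distrib field_simps)
  then show ?thesis unfolding \<mu>2_eq power_add by (simp only: mult_ac)
qed

lemma z1_eigen:
  assumes u: "u \<in> \<O>"
  shows "\<rho> (inv\<^bsub>PSL2 \<O>\<^esub> elem_t F \<epsilon>) (z1 (\<epsilon>\<^sup>2 * u)) = (\<lambda>i. of_real \<mu>1 * z1 u i)"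
proof (rule ext, clarify)
  fix i j
  have tc: "inv\<^bsub>PSL2 \<O>\<^esub> elem_t F \<epsilon> \<in> carrier (PSL2 \<O>)"
    using normalizing_P[OF t_P] by (simp add: h1.normalizing_def)
  show "\<rho> (inv\<^bsub>PSL2 \<O>\<^esub> elem_t F \<epsilon>) (z1 (\<epsilon>\<^sup>2 * u)) (i, j) = of_real \<mu>1 * z1 u (i, j)"
  proof (cases "i \<le> m \<and> j \<le> n")
    case False
    then show ?thesis using \<rho>_closed[OF tc, of "z1 (\<epsilon>\<^sup>2 * u)"] by (auto simp: tensor_space_iff z1_def)
  next
    case ij: True
    show ?thesis
    proof (cases "j = n")
      case True
      have "\<rho> (inv\<^bsub>PSL2 \<O>\<^esub> elem_t F \<epsilon>) (z1 (\<epsilon>\<^sup>2 * u)) (i, j)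
          = of_real (\<epsilon> ^ (m - i) * inverse \<epsilon> ^ i * (\<epsilon>\<^sup>2 * u) ^ (i + 1) * inverse (\<sigma> \<epsilon>) ^ n) / of_nat (i + 1)"
        using ij True by (simp add: \<rho>_t_inv z1_def mult_ac)
      also have "\<epsilon> ^ (m - i) * inverse \<epsilon> ^ i * (\<epsilon>\<^sup>2 * u) ^ (i + 1) * inverse (\<sigma> \<epsilon>) ^ n = \<mu>1 * u ^ (i + 1)"
        unfolding real_power_shift[OF nonzero(1) conjunct1[OF ij]] by (simp add: \<mu>1_eq)
      finally show ?thesis using ij True by (simp add: z1_def)
    qed (use ij in \<open>simp add: \<rho>_t_inv z1_def\<close>)
  qed
qed

lemma z2_eigen:
  assumes u: "u \<in> \<O>"
  shows "\<rho> (inv\<^bsub>PSL2 \<O>\<^esub> elem_t F \<epsilon>) (z2 (\<epsilon>\<^sup>2 * u)) = (\<lambda>i. of_real \<mu>2 * z2 u i)"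
proof (rule ext, clarify)
  fix i j
  have tc: "inv\<^bsub>PSL2 \<O>\<^esub> elem_t F \<epsilon> \<in> carrier (PSL2 \<O>)"
    using normalizing_P[OF t_P] by (simp add: h1.normalizing_def)
  show "\<rho> (inv\<^bsub>PSL2 \<O>\<^esub> elem_t F \<epsilon>) (z2 (\<epsilon>\<^sup>2 * u)) (i, j) = of_real \<mu>2 * z2 u (i, j)"
  proof (cases "i \<le> m \<and> j \<le> n")
    case False
    then show ?thesis using \<rho>_closed[OF tc, of "z2 (\<epsilon>\<^sup>2 * u)"] by (auto simp: tensor_space_iff z2_def)
  next
    case ij: True
    show ?thesis
    proof (cases "i = m")
      case True
      have "\<rho> (inv\<^bsub>PSL2 \<O>\<^esub> elem_t F \<epsilon>) (z2 (\<epsilon>\<^sup>2 * u)) (i, j)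
          = of_real (inverse \<epsilon> ^ m * (\<sigma> \<epsilon> ^ (n - j) * inverse (\<sigma> \<epsilon>) ^ j * ((\<sigma> \<epsilon>)\<^sup>2 * \<sigma> u) ^ (j + 1))) / of_nat (j + 1)"
      proof -
        have z: "z2 (\<epsilon>\<^sup>2 * u) (m, j) = of_real (((\<sigma> \<epsilon>)\<^sup>2 * \<sigma> u) ^ (j + 1)) / of_nat (j + 1)"
          using ij by (simp add: z2_def \<sigma>_\<epsilon>2[OF u])
        show ?thesis
          unfolding \<rho>_t_inv[OF conjunct1[OF ij] conjunct2[OF ij]] unfolding True z by (simp add: mult_ac)
      qed
      also have "inverse \<epsilon> ^ m * (\<sigma> \<epsilon> ^ (n - j) * inverse (\<sigma> \<epsilon>) ^ j * ((\<sigma> \<epsilon>)\<^sup>2 * \<sigma> u) ^ (j + 1))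
          = \<mu>2 * \<sigma> u ^ (j + 1)"
        unfolding real_power_shift[OF nonzero(2) conjunct2[OF ij]] by (simp add: \<mu>2_eq')
      finally show ?thesis using ij True by (simp add: z2_def)
    qed (use ij in \<open>simp add: \<rho>_t_inv z2_def\<close>)
  qed
qed

text \<open>The absolute value of \<open>\<mu>1\<close> is \<epsilon>^(m+n+2) > 1, because
  \<sigma>(\<epsilon>) has absolute value 1/\<epsilon>; and \<open>\<mu>2\<close> is the inverse of
  \<open>\<mu>1\<close>.\<close>

lemma \<mu>_neq_1: "\<mu>1 \<noteq> 1" "\<mu>2 \<noteq> 1"
proof -
  have "\<bar>\<mu>1\<bar> = \<epsilon> ^ (m + 2) * \<epsilon> ^ n"
    using \<epsilon>_gt_1 by (simp add: \<mu>1_eq abs_mult power_abs abs_\<sigma>_\<epsilon>)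
  also have "\<dots> > 1"
    unfolding power_add[symmetric] using \<epsilon>_gt_1 by (intro one_less_power) auto
  finally show 1: "\<mu>1 \<noteq> 1" by auto
  have "\<mu>1 * \<mu>2 = (\<epsilon> * inverse \<epsilon>) ^ (m + 2) * (\<sigma> \<epsilon> * inverse (\<sigma> \<epsilon>)) ^ n"
    unfolding \<mu>1_eq \<mu>2_eq power_mult_distrib by (simp only: mult_ac)
  then have "\<mu>1 * \<mu>2 = 1" using nonzero by simp
  with 1 show "\<mu>2 \<noteq> 1" by auto
qed

sublocale basis: h1_basis "PSL2 \<O>" "grp_U F" "tensor_space m n" \<rho> "elem_t F \<epsilon>" f1 f2 "of_real \<mu>1" "of_real \<mu>2"
proof
  show "h1.normalizing (elem_t F \<epsilon>)" by (rule normalizing_P[OF t_P])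
  show "f1 \<in> h1.Z" "f2 \<in> h1.Z" by (rule f_cocycles)+
next
  fix X assume "X \<in> grp_U F"
  then obtain u where u: "X = low u" "u \<in> \<O>" by (auto simp: grp_U_eq)
  show "\<rho> (inv\<^bsub>PSL2 \<O>\<^esub> elem_t F \<epsilon>)
      (f1 (elem_t F \<epsilon> \<otimes>\<^bsub>PSL2 \<O>\<^esub> X \<otimes>\<^bsub>PSL2 \<O>\<^esub> inv\<^bsub>PSL2 \<O>\<^esub> elem_t F \<epsilon>)) = (\<lambda>i. of_real \<mu>1 * f1 X i)"
    using u \<epsilon>2_O[OF u(2)] by (simp add: t_conj f1_low z1_eigen)
  show "\<rho> (inv\<^bsub>PSL2 \<O>\<^esub> elem_t F \<epsilon>)
      (f2 (elem_t F \<epsilon> \<otimes>\<^bsub>PSL2 \<O>\<^esub> X \<otimes>\<^bsub>PSL2 \<O>\<^esub> inv\<^bsub>PSL2 \<O>\<^esub> elem_t F \<epsilon>)) = (\<lambda>i. of_real \<mu>2 * f2 X i)"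
    using u \<epsilon>2_O[OF u(2)] by (simp add: t_conj f2_low z2_eigen)
next
  fix f assume f: "f \<in> h1.Z"
  \<comment> \<open>Pulling back along \<open>low\<close> turns a cocycle of U into one on the
    integers, where the decomposition is available.\<close>
  have "cocycle (\<lambda>u. f (low u))"
    using f unfolding cocycle_def h1.Z_iff ball_grp_U by (simp add: low_mult \<rho>_low)
  then obtain v \<alpha> \<beta> where v: "v \<in> tensor_space m n"
    "\<And>u. u \<in> \<O> \<Longrightarrow> f (low u) = (act u v - v) + (\<lambda>i. \<alpha> * z1 u i) + (\<lambda>i. \<beta> * z2 u i)"
    by (rule cocycle_decompose) blast
  have "f X = (\<rho> X v - v) + (\<lambda>i. \<alpha> * f1 X i) + (\<lambda>i. \<beta> * f2 X i)" if "X \<in> grp_U F" for X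
  proof -
    obtain u where u: "X = low u" "u \<in> \<O>" using \<open>X \<in> grp_U F\<close> by (auto simp: grp_U_eq)
    then show ?thesis using v(2)[OF u(2)] by (simp add: f1_low f2_low \<rho>_low)
  qed
  then show "\<exists>v\<in>tensor_space m n. \<exists>\<alpha> \<beta>. \<forall>X\<in>grp_U F.
      f X = (\<rho> X v - v) + (\<lambda>i. \<alpha> * f1 X i) + (\<lambda>i. \<beta> * f2 X i)"
    using v(1) by blast
next
  fix v \<alpha> \<beta>
  assume v: "v \<in> tensor_space m n"
    and eq: "\<forall>X\<in>grp_U F. (\<lambda>i. \<alpha> * f1 X i) + (\<lambda>i. \<beta> * f2 X i) = \<rho> X v - v"
  show "\<alpha> = 0 \<and> \<beta> = 0"
  proof (rule z1_z2_independent[OF n_le_m])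
    fix u assume u: "u \<in> \<O>"
    with eq show "(\<lambda>i. \<alpha> * z1 u i) + (\<lambda>i. \<beta> * z2 u i) = act u v - v"
      unfolding ball_grp_U by (simp add: f1_low f2_low \<rho>_low)
  qed
qed

lemma invariants_zero:
  "H1_invariants (PSL2 \<O>) (grp_P F) (grp_U F) (tensor_space m n) \<rho>
    = {H1_zero (PSL2 \<O>) (grp_U F) (tensor_space m n) \<rho>}"
  by (rule basis.invariants)
     (use \<mu>_neq_1 in \<open>auto intro: t_P normalizing_P grp_P_mult subsetD[OF grp_U_subset_grp_P]\<close>)

end

theorem theorem3p6:
  fixes F :: "real set" and \<sigma> :: "real \<Rightarrow> real" and \<epsilon> :: real and l\<^sub>1 l\<^sub>2 :: nat
  assumes "real_quadratic_field F"
    and "galois_conjugation F \<sigma>"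
    and "fundamental_unit F \<epsilon>"
    and "l\<^sub>1 \<ge> l\<^sub>2" and "[l\<^sub>1 = l\<^sub>2] (mod 2)"
  shows "H1_eigenvalues (PSL2 (ring_of_integers F)) (grp_U F) (tensor_space l\<^sub>1 l\<^sub>2)
           (rep_V \<sigma> l\<^sub>1 l\<^sub>2) (elem_t F \<epsilon>)
         = {complex_of_real (\<epsilon> powi (int l\<^sub>1 + 2) * \<sigma> \<epsilon> powi (- int l\<^sub>2)),
            complex_of_real (\<epsilon> powi (- int l\<^sub>1 - 2) * \<sigma> \<epsilon> powi (int l\<^sub>2))}
       \<and> H1_invariants (PSL2 (ring_of_integers F)) (grp_P F) (grp_U F) (tensor_space l\<^sub>1 l\<^sub>2)
           (rep_V \<sigma> l\<^sub>1 l\<^sub>2)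
         = {H1_zero (PSL2 (ring_of_integers F)) (grp_U F) (tensor_space l\<^sub>1 l\<^sub>2)
           (rep_V \<sigma> l\<^sub>1 l\<^sub>2)}"
proof -
  interpret h1_unipotent F \<sigma> \<epsilon> l\<^sub>1 l\<^sub>2
    using assms by unfold_locales
  show ?thesis
    using basis.eigenvalues invariants_zero unfolding \<mu>1_def \<mu>2_def by (rule conjI)
qed

end
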